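(* Let $p$ be an odd prime and $\alpha,\beta,\gamma,\delta\in\mathbb Z_p$. Suppose that (i) $\max\{\langle-\alpha\rangle_p,\langle-\beta\rangle_p,\langle-\gamma\rangle_p\}\leq \langle-\delta\rangle_p$; (ii) $\langle-\alpha\rangle_p+\langle-\beta\rangle_p+\langle-\gamma\rangle_p<p+\langle-\delta\rangle_p$; (iii) $\langle-\beta\rangle_p+\langle-\gamma\rangle_p\geq\langle-\delta\rangle_p$; (iv) $(\delta)_{p-1}\not\equiv0\pmod{p^2}$ and $(1+\delta-\beta-\gamma)_{p-1}\not\equiv0\pmod{p^2}$. Then $$ {}_3F_2\bigg[\begin{matrix}\alpha&\beta&\gamma\\&1&\delta\end{matrix}\bigg|\,1\bigg]_{p-1}\equiv\frac{\Gamma_p(\delta)\Gamma_p(1+\delta-\alpha-\beta-\gamma)}{\Gamma_p(\delta-\alpha)\Gamma_p(1+\delta-\beta-\gamma)}\cdot{}_3F_2\bigg[\begin{matrix}\alpha&1-\beta&1-\gamma\\&1&1+\delta-\beta-\gamma\end{matrix}\bigg|\,1\bigg]_{p-1}\pmod{p^2}. $$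
   Context: $\mathbb Z_p$ denotes the $p$-adic integers. For $\alpha\in\mathbb Z_p$, $\langle\alpha\rangle_p$ is the unique integer in $\{0,1,\ldots,p-1\}$ congruent to $\alpha$ modulo $p$. Pochhammer symbol: $(x)_0=1$, $(x)_k=x(x+1)\cdots(x+k-1)$. For $n\ge 0$ the truncated hypergeometric series is ${}_{m+1}F_m\Big[\begin{matrix}\alpha_0&\alpha_1&\ldots&\alpha_m\\&\beta_1&\ldots&\beta_m\end{matrix}\Big|\,z\Big]_n=\sum_{k=0}^{n}\frac{(\alpha_0)_k\cdots(\alpha_m)_k}{(\beta_1)_k\cdots(\beta_m)_k}\cdot\frac{z^k}{k!}$. $\Gamma_p$ is Morita's $p$-adic gamma function: $\Gamma_p(n)=(-1)^n\prod_{1\le j<n,\ p\nmid j}j$ for integers $n\ge1$, $\Gamma_p(0)=1$, extended to $\mathbb Z_p$ by continuity. For $x,y\in\mathbb Q_p$, $x\equiv y\pmod{p^2}$ means $x-y\in p^2\mathbb Z_p$. *)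

theory Defs
  imports
    Complex_Main
    "HOL-Computational_Algebra.Fraction_Field"
    "HOL-Number_Theory.Residue_Primitive_Roots"
    "Berlekamp_Zassenhaus.Finite_Field"
begin

section \<open>The ring of p-adic integers\<close>

text \<open>
  The prime p is the cardinality of the index type, so that a type variable of class
  \<open>prime_card\<close> ranges over all primes. The p-adic integers are the inverse limit of the
  rings of integers modulo p ^ n, the n-th component being represented by its least
  nonnegative residue.
\<close>

typedef (overloaded) ('p :: prime_card) padic_int =
  "{f :: nat \<Rightarrow> int. (\<forall>n. f n \<in> {0..<int CARD('p) ^ n}) \<and> (\<forall>n. f (Suc n) mod int CARD('p) ^ n = f n)}"
  morphisms padic_proj Abs_padic_int
  by (rule exI[of _ "\<lambda>_. 0"]) (simp add: prime_gt_0_nat prime_card)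

setup_lifting type_definition_padic_int

lemma prime_CARD: "prime (int CARD('p :: prime_card))"
  using prime_card[where 'a = 'p] by simp

lemma CARD_gt_1: "int CARD('p :: prime_card) > 1"
  using prime_gt_1_int[OF prime_CARD[where 'p = 'p]] .

lemma CARD_power_pos [simp]: "int CARD('p :: prime_card) ^ n > 0"
  using CARD_gt_1[where 'p = 'p] by (intro zero_less_power) linarith

lemma padic_proj_bounds:
  "padic_proj (x :: 'p :: prime_card padic_int) n \<in> {0..<int CARD('p) ^ n}"
  using padic_proj[of x] by blast

lemma padic_proj_0 [simp]: "padic_proj x 0 = 0"
  using padic_proj_bounds[of x 0] by simp

lemma padic_proj_mod_self [simp]:
  "padic_proj (x :: 'p :: prime_card padic_int) n mod int CARD('p) ^ n = padic_proj x n"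
  using padic_proj_bounds[of x n] by simp

lemma padic_proj_mod:
  assumes "m \<le> n"
  shows "padic_proj (x :: 'p :: prime_card padic_int) n mod int CARD('p) ^ m = padic_proj x m"
  using assms
proof (induction n rule: dec_induct)
  case base
  show ?case by simp
next
  case (step n)
  have "padic_proj x (Suc n) mod int CARD('p) ^ m
      = padic_proj x (Suc n) mod int CARD('p) ^ n mod int CARD('p) ^ m"
    using step.hyps by (simp add: mod_mod_cancel le_imp_power_dvd)
  also have "\<dots> = padic_proj x n mod int CARD('p) ^ m"
    using padic_proj[of x] by simp
  finally show ?case using step.IH by simp
qed

lemma compatible_mod:
  fixes h :: "nat \<Rightarrow> int"
  assumes "\<And>n. h (Suc n) mod int CARD('p :: prime_card) ^ n = h n mod int CARD('p) ^ n"
  shows "(\<forall>n. h n mod int CARD('p) ^ n \<in> {0..<int CARD('p) ^ n}) \<and>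
    (\<forall>n. h (Suc n) mod int CARD('p) ^ Suc n mod int CARD('p) ^ n = h n mod int CARD('p) ^ n)"
proof (intro conjI allI)
  fix n
  show "h n mod int CARD('p) ^ n \<in> {0..<int CARD('p) ^ n}"
    using CARD_power_pos[where 'p = 'p and n = n] by simp
  have "h (Suc n) mod int CARD('p) ^ Suc n mod int CARD('p) ^ n = h (Suc n) mod int CARD('p) ^ n"
    by (rule mod_mod_cancel) simp
  then show "h (Suc n) mod int CARD('p) ^ Suc n mod int CARD('p) ^ n = h n mod int CARD('p) ^ n"
    using assms by simp
qed

instantiation padic_int :: (prime_card) comm_ring_1
begin

lift_definition zero_padic_int :: "'a padic_int" is "\<lambda>n. 0 mod int CARD('a) ^ n"
  by (rule compatible_mod) simp

lift_definition one_padic_int :: "'a padic_int" is "\<lambda>n. 1 mod int CARD('a) ^ n"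
  by (rule compatible_mod) simp

lift_definition plus_padic_int :: "'a padic_int \<Rightarrow> 'a padic_int \<Rightarrow> 'a padic_int"
  is "\<lambda>f g n. (f n + g n) mod int CARD('a) ^ n"
proof (rule compatible_mod, goal_cases)
  case (1 f g n)
  then show ?case by (metis mod_add_eq mod_mod_trivial)
qed

lift_definition uminus_padic_int :: "'a padic_int \<Rightarrow> 'a padic_int"
  is "\<lambda>f n. (- f n) mod int CARD('a) ^ n"
proof (rule compatible_mod, goal_cases)
  case (1 f n)
  then show ?case by (metis mod_minus_eq mod_mod_trivial)
qed

lift_definition times_padic_int :: "'a padic_int \<Rightarrow> 'a padic_int \<Rightarrow> 'a padic_int"
  is "\<lambda>f g n. (f n * g n) mod int CARD('a) ^ n"
proof (rule compatible_mod, goal_cases)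
  case (1 f g n)
  then show ?case by (metis mod_mult_eq mod_mod_trivial)
qed

definition minus_padic_int :: "'a padic_int \<Rightarrow> 'a padic_int \<Rightarrow> 'a padic_int"
  where "x - y = x + - (y :: 'a padic_int)"

instance
proof
  fix a b c :: "'a padic_int"
  show "a * b * c = a * (b * c)"
    by transfer (simp add: fun_eq_iff mod_mult_left_eq mod_mult_right_eq mult.assoc)
  show "a * b = b * a"
    by transfer (simp add: fun_eq_iff mult.commute)
  show "1 * a = a"
    by transfer (simp add: fun_eq_iff mod_mult_left_eq)
  show "a + b + c = a + (b + c)"
    by transfer (simp add: fun_eq_iff mod_add_left_eq mod_add_right_eq add.assoc)
  show "a + b = b + a"
    by transfer (simp add: fun_eq_iff add.commute)
  show "0 + a = a"
    by transfer (simp add: fun_eq_iff)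
  show "- a + a = 0"
    by transfer (simp add: fun_eq_iff mod_add_left_eq)
  show "a - b = a + - b"
    by (rule minus_padic_int_def)
  show "(a + b) * c = a * c + b * c"
    by transfer (simp add: fun_eq_iff mod_mult_left_eq mod_add_eq distrib_right)
  show "(0 :: 'a padic_int) \<noteq> 1"
  proof
    assume "(0 :: 'a padic_int) = 1"
    then have "padic_proj (0 :: 'a padic_int) 1 = padic_proj 1 1" by simp
    then show False
      using CARD_gt_1[where 'p = 'a] by transfer simp
  qed
qed

end

lemma padic_eq_iff: "x = y \<longleftrightarrow> (\<forall>n. padic_proj x n = padic_proj y n)"
  by (metis ext padic_proj_inject)

lemma padic_proj_zero [simp]: "padic_proj 0 n = 0"
  by transfer simp

lemma padic_proj_one: "padic_proj (1 :: 'p :: prime_card padic_int) n = 1 mod int CARD('p) ^ n"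
  by transfer simp

lemma padic_proj_add:
  "padic_proj (x + y :: 'p :: prime_card padic_int) n
    = (padic_proj x n + padic_proj y n) mod int CARD('p) ^ n"
  by transfer simp

lemma padic_proj_uminus:
  "padic_proj (- x :: 'p :: prime_card padic_int) n = (- padic_proj x n) mod int CARD('p) ^ n"
  by transfer simp

lemma padic_proj_mult:
  "padic_proj (x * y :: 'p :: prime_card padic_int) n
    = (padic_proj x n * padic_proj y n) mod int CARD('p) ^ n"
  by transfer simp

lemma padic_proj_diff:
  "padic_proj (x - y :: 'p :: prime_card padic_int) n
    = (padic_proj x n - padic_proj y n) mod int CARD('p) ^ n"
  unfolding minus_padic_int_def padic_proj_add padic_proj_uminus mod_add_right_eq by simp

lemma padic_proj_of_nat:
  "padic_proj (of_nat k :: 'p :: prime_card padic_int) n = int k mod int CARD('p) ^ n"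
proof (induction k)
  case (Suc k)
  have "padic_proj (of_nat (Suc k) :: 'p padic_int) n
      = (1 mod int CARD('p) ^ n + int k mod int CARD('p) ^ n) mod int CARD('p) ^ n"
    unfolding of_nat_Suc padic_proj_add padic_proj_one Suc.IH ..
  also have "\<dots> = int (Suc k) mod int CARD('p) ^ n"
    unfolding mod_add_eq by simp
  finally show ?case .
qed simp

instance padic_int :: (prime_card) idom
proof
  fix x y :: "'a padic_int"
  let ?p = "int CARD('a)"
  assume "x \<noteq> 0" "y \<noteq> 0"
  then obtain a b where a: "padic_proj x a \<noteq> 0" and b: "padic_proj y b \<noteq> 0"
    by (auto simp: padic_eq_iff)
  let ?x = "padic_proj x (a + b)" and ?y = "padic_proj y (a + b)"
  have nx: "\<not> ?p ^ a dvd ?x"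
    using a padic_proj_mod[of a "a + b" x] by (auto simp: dvd_eq_mod_eq_0)
  have ny: "\<not> ?p ^ b dvd ?y"
    using b padic_proj_mod[of b "a + b" y] by (auto simp: dvd_eq_mod_eq_0)
  have x0: "?x \<noteq> 0" and y0: "?y \<noteq> 0" using nx ny by auto
  have pe: "prime_elem ?p" using prime_CARD[where 'p = 'a] by simp
  have nu: "\<not> is_unit ?p" using pe by (rule prime_elem_not_unit)
  have "multiplicity ?p ?x < a" "multiplicity ?p ?y < b"
    using multiplicity_lessI[OF x0 nu nx] multiplicity_lessI[OF y0 nu ny] by auto
  then have "multiplicity ?p (?x * ?y) < a + b"
    by (simp add: prime_elem_multiplicity_mult_distrib[OF pe x0 y0])
  then have "\<not> ?p ^ (a + b) dvd ?x * ?y"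
    using multiplicity_geI[of "?x * ?y" ?p "a + b"] x0 y0 nu by auto
  then have "padic_proj (x * y) (a + b) \<noteq> 0"
    by (simp add: padic_proj_mult dvd_eq_mod_eq_0)
  then show "x * y \<noteq> 0" by auto
qed

instance padic_int :: (prime_card) ring_char_0
proof
  show "inj (of_nat :: nat \<Rightarrow> 'a padic_int)"
  proof (rule injI)
    fix k l :: nat
    assume eq: "(of_nat k :: 'a padic_int) = of_nat l"
    let ?n = "k + l"
    have "k + l < CARD('a) ^ ?n"
      using CARD_gt_1[where 'p = 'a] by (intro power_gt_expt) simp
    then have "int (k + l) < int CARD('a) ^ ?n"
      by (metis of_nat_less_iff of_nat_power)
    then have "int k < int CARD('a) ^ ?n" "int l < int CARD('a) ^ ?n"
      by linarith+
    then have "int k mod int CARD('a) ^ ?n = int k" "int l mod int CARD('a) ^ ?n = int l"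
      by (simp_all only: mod_pos_pos_trivial of_nat_0_le_iff)
    then show "k = l"
      using arg_cong[OF eq, of "\<lambda>x. padic_proj x ?n"] by (simp add: padic_proj_of_nat)
  qed
qed

lemma padic_dvd_iff:
  "of_nat CARD('p) ^ n dvd (x :: 'p :: prime_card padic_int) \<longleftrightarrow> padic_proj x n = 0"
proof
  let ?p = "int CARD('p)"
  assume "of_nat CARD('p) ^ n dvd x"
  then obtain y where "x = of_nat (CARD('p) ^ n) * y" by (auto elim: dvdE)
  then show "padic_proj x n = 0"
    by (simp add: padic_proj_mult padic_proj_of_nat del: of_nat_power) simp
next
  let ?p = "int CARD('p)"
  assume z: "padic_proj x n = 0"
  define f where "f = (\<lambda>k. padic_proj x (n + k) div ?p ^ n)"
  have dvd: "?p ^ n dvd padic_proj x (n + k)" for k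
    using padic_proj_mod[of n "n + k" x] z by (simp add: dvd_eq_mod_eq_0)
  then have fe: "padic_proj x (n + k) = ?p ^ n * f k" for k
    by (simp add: f_def)
  have pp: "?p ^ n > 0" by simp
  have "f k \<in> {0..<?p ^ k}" for k
    using padic_proj_bounds[of x "n + k"] pp unfolding fe
    by (simp add: power_add zero_le_mult_iff not_less)
  moreover have "f (Suc k) mod ?p ^ k = f k" for k
  proof -
    have "?p ^ n * (f (Suc k) mod ?p ^ k) = padic_proj x (n + Suc k) mod ?p ^ (n + k)"
      by (simp only: fe power_add mult_mod_right)
    also have "\<dots> = ?p ^ n * f k"
      using padic_proj_mod[of "n + k" "n + Suc k" x] fe[of k] by simp
    finally show ?thesis using pp by simp
  qed
  ultimately have f: "padic_proj (Abs_padic_int f :: 'p padic_int) = f"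
    by (intro Abs_padic_int_inverse) auto
  have "x = of_nat (CARD('p) ^ n) * Abs_padic_int f"
    unfolding padic_eq_iff
  proof
    fix k
    have "padic_proj (of_nat (CARD('p) ^ n) * Abs_padic_int f :: 'p padic_int) k = ?p ^ n * f k mod ?p ^ k"
      by (simp add: padic_proj_mult padic_proj_of_nat f mod_mult_left_eq del: of_nat_power)
         (simp add: mod_mult_left_eq)
    also have "\<dots> = padic_proj x k"
      using padic_proj_mod[of k "n + k" x] fe[of k] by simp
    finally show "padic_proj x k = padic_proj (of_nat (CARD('p) ^ n) * Abs_padic_int f :: 'p padic_int) k" ..
  qed
  then show "of_nat CARD('p) ^ n dvd x" by simp
qed

definition padic_residue :: "'p :: prime_card padic_int \<Rightarrow> nat"
  where "padic_residue x = (THE a. a < CARD('p) \<and> of_nat CARD('p) dvd x - of_nat a)"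

lemma padic_residue_unique:
  "\<exists>!a. a < CARD('p) \<and> of_nat CARD('p) dvd (x :: 'p :: prime_card padic_int) - of_nat a"
proof -
  have b: "padic_proj x 1 \<in> {0..<int CARD('p)}"
    using padic_proj_bounds[of x 1] by simp
  have iff: "of_nat CARD('p) dvd x - of_nat a \<longleftrightarrow> int a = padic_proj x 1" if "a < CARD('p)" for a
  proof -
    have "of_nat CARD('p) dvd x - of_nat a \<longleftrightarrow> (padic_proj x 1 - int a) mod int CARD('p) = 0"
      using padic_dvd_iff[of 1 "x - of_nat a"] that
      by (simp add: padic_proj_diff padic_proj_of_nat)
    also have "\<dots> \<longleftrightarrow> padic_proj x 1 mod int CARD('p) = int a mod int CARD('p)"
      by (simp add: mod_eq_dvd_iff dvd_eq_mod_eq_0)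
    finally show ?thesis using b that by auto
  qed
  obtain r where r: "padic_proj x 1 = int r"
    using b by (metis atLeastLessThan_iff nonneg_int_cases)
  have "r < CARD('p)" using b r by simp
  show ?thesis
  proof (rule ex1I[of _ r])
    show "r < CARD('p) \<and> of_nat CARD('p) dvd x - of_nat r"
      using iff[of r] r \<open>r < CARD('p)\<close> by simp
    show "a = r" if "a < CARD('p) \<and> of_nat CARD('p) dvd x - of_nat a" for a
      using iff[of a] r that by simp
  qed
qed

section \<open>The p-adic metric and the p-adic gamma function\<close>

text \<open>For distinct x and y the exponent below is the p-adic valuation of x - y.\<close>

instantiation padic_int :: (prime_card) metric_space
begin

definition dist_padic_int :: "'a padic_int \<Rightarrow> 'a padic_int \<Rightarrow> real"
  where "dist x (y :: 'a padic_int) = (if x = y then 0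
    else inverse (real CARD('a)) ^ (LEAST n. \<not> of_nat CARD('a) ^ Suc n dvd x - y))"

definition uniformity_padic_int :: "('a padic_int \<times> 'a padic_int) filter"
  where "uniformity_padic_int = (INF e\<in>{0 <..}. principal {(x :: 'a padic_int, y). dist x y < e})"

definition open_padic_int :: "'a padic_int set \<Rightarrow> bool"
  where "open_padic_int U \<longleftrightarrow>
    (\<forall>x\<in>U. eventually (\<lambda>(x', y :: 'a padic_int). x' = x \<longrightarrow> y \<in> U) uniformity)"

lemma dist_padic_le_iff:
  "dist x y \<le> inverse (real CARD('a)) ^ n \<longleftrightarrow> of_nat CARD('a) ^ n dvd x - (y :: 'a padic_int)"
proof (cases "x = y")
  case True
  then show ?thesis by (simp add: dist_padic_int_def)
next
  case False
  let ?p = "of_nat CARD('a) :: 'a padic_int"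
  define v where "v = (LEAST n. \<not> ?p ^ Suc n dvd x - y)"
  from False obtain m where m: "padic_proj (x - y) m \<noteq> 0"
    by (metis eq_iff_diff_eq_0 padic_eq_iff padic_proj_zero)
  then obtain k where "m = Suc k"
    by (cases m) auto
  then have "\<exists>n. \<not> ?p ^ Suc n dvd x - y"
    using m padic_dvd_iff[of "Suc k" "x - y"] by blast
  then have v1: "\<not> ?p ^ Suc v dvd x - y"
    unfolding v_def by (rule LeastI_ex)
  have v2: "?p ^ n dvd x - y" if "n \<le> v" for n
  proof (cases n)
    case (Suc k)
    then show ?thesis using not_less_Least[of k "\<lambda>n. \<not> ?p ^ Suc n dvd x - y"] that
      unfolding v_def by auto
  qed simp
  have "?p ^ n dvd x - y \<longleftrightarrow> n \<le> v"
    using v1 v2 by (meson dvd_trans le_imp_power_dvd not_less_eq_eq)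
  moreover have "inverse (real CARD('a)) ^ v \<le> inverse (real CARD('a)) ^ n \<longleftrightarrow> n \<le> v"
  proof -
    have "real CARD('a) > 1" using CARD_gt_1[where 'p = 'a] by simp
    then have "0 < inverse (real CARD('a))" "inverse (real CARD('a)) < 1"
      by (auto simp: inverse_less_1_iff)
    then show ?thesis by (rule power_decreasing_iff)
  qed
  ultimately show ?thesis using False by (simp add: dist_padic_int_def v_def)
qed

instance
proof
  fix x y z :: "'a padic_int"
  let ?q = "inverse (real CARD('a))"
  have q: "?q > 0" using CARD_gt_1[where 'p = 'a] by simp
  show "uniformity = (INF e\<in>{0 <..}. principal {(x :: 'a padic_int, y). dist x y < e})"
    by (rule uniformity_padic_int_def)
  show "open U \<longleftrightarrow> (\<forall>x\<in>U. eventually (\<lambda>(x', y). x' = x \<longrightarrow> y \<in> U) uniformity)"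
    for U :: "'a padic_int set"
    by (rule open_padic_int_def)
  show "dist x y = 0 \<longleftrightarrow> x = y"
    by (simp add: dist_padic_int_def)
  have form: "\<exists>n. dist u v = ?q ^ n" if "u \<noteq> v" for u v :: "'a padic_int"
    using that unfolding dist_padic_int_def by auto
  have nonneg: "dist u v \<ge> 0" for u v :: "'a padic_int"
    unfolding dist_padic_int_def by simp
  have sym: "dist u v = dist v u" for u v :: "'a padic_int"
    unfolding dist_padic_int_def
    by (simp only: dvd_minus_iff[of _ "u - v", symmetric] minus_diff_eq eq_commute[of u v])
  have ultra: "dist x y \<le> ?q ^ n" if "dist x z \<le> ?q ^ n" "dist z y \<le> ?q ^ n" for n
    using dvd_add[OF that[unfolded dist_padic_le_iff]] by (simp add: dist_padic_le_iff)
  show "dist x y \<le> dist x z + dist y z"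
  proof (cases "x = z \<or> y = z")
    case True
    moreover have "dist u u = 0" for u :: "'a padic_int"
      by (simp add: dist_padic_int_def)
    ultimately show ?thesis using nonneg[of x y] sym[of x y] nonneg[of x z] nonneg[of y z] by auto
  next
    case False
    obtain k where k: "dist x z = ?q ^ k" using form[of x z] False by blast
    obtain l where l: "dist z y = ?q ^ l" using form[of z y] False by metis
    have "dist x y \<le> max (dist x z) (dist z y)"
    proof (cases "dist x z \<le> dist z y")
      case True
      then show ?thesis using ultra[of l] l by simp
    next
      case False
      then show ?thesis using ultra[of k] k by simp
    qed
    then show ?thesis using nonneg[of x z] nonneg[of z y] sym[of y z] by linarith
  qed
qed

end

text \<open>Morita's gamma function on the nonnegative integers; for n = 0 the formula gives 1.\<close>

definition morita_gamma_nat :: "nat \<Rightarrow> nat \<Rightarrow> int"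
  where "morita_gamma_nat p n = (- 1) ^ n * (\<Prod>j | 1 \<le> j \<and> j < n \<and> \<not> p dvd j. int j)"

text \<open>
  The natural numbers are dense in the p-adic integers, so the continuous extension is unique;
  that it exists for odd p is \<open>padic_Gamma_ex1\<close> below.
\<close>

definition padic_Gamma :: "'p :: prime_card padic_int \<Rightarrow> 'p padic_int"
  where "padic_Gamma = (THE g. continuous_on UNIV g \<and>
    (\<forall>n. g (of_nat n) = of_int (morita_gamma_nat CARD('p) n)))"

lemma wilson_prime_power:
  fixes p k :: nat
  assumes p: "prime p" "odd p" and k: "k > 0"
  shows "[(\<Prod>j\<in>totatives (p ^ k). int j) = - 1] (mod int p ^ k)"
proof -
  obtain g where "\<forall>k>0. residue_primroot (p ^ k) g"
    using residue_primroot_odd_prime_power_exists[OF p] .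
  then have g: "residue_primroot (p ^ k) g" using k by blast
  define m where "m = p ^ k"
  define t where "t = totient m"
  have p3: "p \<ge> 3" using p prime_ge_2_nat[of p] by (cases "p = 2") auto
  have "p ^ 1 \<le> p ^ k" using k p3 by (intro power_increasing) auto
  then have m2: "m > 2" using p3 by (simp add: m_def)
  have te: "even t" using totient_even[OF m2] by (simp add: t_def)
  have tpos: "t > 0" using m2 by (simp add: t_def)
  have ord: "ord m g = t" and cop: "coprime m g"
    using g by (simp_all add: residue_primroot_def m_def t_def)
  have bij: "bij_betw (\<lambda>i. g ^ i mod m) {..<t} (totatives m)"
    using residue_primroot_is_generator[of m g] g m2 unfolding m_def t_def by auto
  define h where "h = g ^ (t div 2)"
  have h2: "[int h * int h = 1] (mod int m)"
  proof -
    have "h * h = g ^ t" using te by (simp add: h_def flip: power_add mult_2)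
    moreover have "[g ^ t = 1] (mod m)" unfolding ord_divides ord by simp
    ultimately show ?thesis by (metis cong_int_iff of_nat_1 of_nat_mult)
  qed
  have h1: "\<not> [int h = 1] (mod int m)"
  proof
    assume "[int h = 1] (mod int m)"
    then have "[g ^ (t div 2) = 1] (mod m)" unfolding h_def by (metis cong_int_iff of_nat_1)
    then have "t dvd t div 2" unfolding ord_divides ord .
    then show False using te tpos by (auto elim!: evenE dest: dvd_imp_le)
  qed
  have hm: "[int h = - 1] (mod int m)"
  proof -
    have d: "int p ^ k dvd (int h - 1) * (int h + 1)"
      using h2 by (simp add: cong_iff_dvd_diff algebra_simps m_def)
    have pp: "prime_elem (int p)" using p by simp
    have "\<not> (int p dvd int h - 1 \<and> int p dvd int h + 1)"
    proof
      assume "int p dvd int h - 1 \<and> int p dvd int h + 1"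
      then have "int p dvd (int h + 1) - (int h - 1)" by (blast intro: dvd_diff)
      then have "int p dvd 2" by simp
      then show False using p3 zdvd_imp_le by fastforce
    qed
    then have "coprime (int p ^ k) (int h - 1) \<or> coprime (int p ^ k) (int h + 1)"
      using p by (metis coprime_power_left_iff prime_imp_coprime prime_int_iff prime_nat_int_transfer)
    then show ?thesis
    proof
      assume "coprime (int p ^ k) (int h - 1)"
      then have "int p ^ k dvd int h + 1" using d by (simp add: coprime_dvd_mult_right_iff)
      then show ?thesis by (simp add: cong_iff_dvd_diff m_def)
    next
      assume "coprime (int p ^ k) (int h + 1)"
      then have "int p ^ k dvd int h - 1" using d by (simp add: coprime_dvd_mult_left_iff)
      then show ?thesis using h1 by (simp add: cong_iff_dvd_diff m_def)
    qed
  qed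
  have "(\<Prod>j\<in>totatives m. int j) = (\<Prod>i<t. int (g ^ i mod m))"
    using prod.reindex_bij_betw[OF bij, of int] by simp
  also have "[\<dots> = (\<Prod>i<t. int g ^ i)] (mod int m)"
    by (intro cong_prod) (simp add: cong_def of_nat_mod)
  also have "(\<Prod>i<t. int g ^ i) = int g ^ (\<Sum>i<t. i)"
    by (simp add: power_sum)
  also have "(\<Sum>i<t. i) = (t div 2) * (t - 1)"
    using te Sum_Ico_nat[of 0 t] by (auto elim!: evenE simp: lessThan_atLeast0)
  also have "int g ^ \<dots> = int h ^ (t - 1)"
    by (simp add: h_def power_mult)
  also have "[\<dots> = (- 1) ^ (t - 1)] (mod int m)"
    using hm by (rule cong_pow)
  also have "(- 1 :: int) ^ (t - 1) = - 1"
    using te tpos by simp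
  finally show ?thesis by (simp add: m_def)
qed

lemma morita_gamma_nat_add:
  fixes p k n :: nat
  assumes p: "prime p" "odd p" and k: "k > 0"
  shows "[morita_gamma_nat p (n + p ^ k) = morita_gamma_nat p n] (mod int p ^ k)"
proof -
  define m where "m = p ^ k"
  have m1: "m > 1" unfolding m_def using prime_gt_1_nat[OF p(1)] k by (rule one_less_power)
  have cop: "coprime j m \<longleftrightarrow> \<not> p dvd j" for j
  proof -
    have "coprime j m \<longleftrightarrow> coprime p j"
      using k by (simp add: m_def coprime_commute)
    also have "\<dots> \<longleftrightarrow> \<not> p dvd j"
      using p(1) prime_imp_coprime[of p j] not_coprimeI[of p p j] by auto
    finally show ?thesis .
  qed
  define A where "A = {j. 1 \<le> j \<and> j < n \<and> \<not> p dvd j}"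
  define B where "B = {j. n \<le> j \<and> j < n + m \<and> \<not> p dvd j}"
  have fin: "finite A" "finite B" unfolding A_def B_def by auto
  have "\<not> p dvd j \<Longrightarrow> 1 \<le> j" for j by (cases j) auto
  then have un: "{j. 1 \<le> j \<and> j < n + m \<and> \<not> p dvd j} = A \<union> B"
    unfolding A_def B_def by auto
  have bij: "bij_betw (\<lambda>j. j mod m) B (totatives m)"
  proof (rule bij_betw_imageI)
    show inj: "inj_on (\<lambda>j. j mod m) B"
    proof (rule inj_onI)
      fix x y assume xy: "x \<in> B" "y \<in> B" "x mod m = y mod m"
      have "m dvd nat \<bar>int x - int y\<bar>"
      proof -
        have "int m dvd int x - int y"
          using xy(3) by (metis mod_eq_dvd_iff of_nat_mod)
        then show ?thesis by (simp add: nat_abs_dvd_iff flip: int_dvd_int_iff)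
      qed
      moreover have "nat \<bar>int x - int y\<bar> < m" using xy(1,2) unfolding B_def by auto
      ultimately show "x = y"
        using nat_dvd_not_less[of "nat \<bar>int x - int y\<bar>" m] by (cases "x = y") auto
    qed
    show "(\<lambda>j. j mod m) ` B = totatives m"
    proof (intro equalityI subsetI)
      fix y assume "y \<in> (\<lambda>j. j mod m) ` B"
      then obtain j where j: "j \<in> B" "y = j mod m" by blast
      have "coprime j m" using j cop unfolding B_def by auto
      then have c: "coprime y m" using j(2) m1 by simp
      have "y \<noteq> 0" using c m1 by (cases "y = 0") auto
      then show "y \<in> totatives m" using c j(2) m1 by (simp add: in_totatives_iff less_imp_le)
    next
      fix y assume y: "y \<in> totatives m"
      then have yl: "y < m" using m1 by (rule totatives_less)
      define j where "j = n + (y + m * n - n) mod m"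
      have "n \<le> y + m * n" using m1 by (simp add: trans_le_add2)
      then have "j mod m = y"
        unfolding j_def mod_add_right_eq using yl by simp
      moreover have "j < n + m" "n \<le> j" using m1 by (auto simp: j_def)
      moreover have "\<not> p dvd j"
        using y \<open>j mod m = y\<close> cop[of j] m1 by (auto simp: in_totatives_iff)
      ultimately show "y \<in> (\<lambda>j. j mod m) ` B"
        unfolding B_def by (intro image_eqI[of _ _ j]) auto
    qed
  qed
  have "[(\<Prod>j\<in>B. int j) = (\<Prod>j\<in>B. int (j mod m))] (mod int m)"
    by (intro cong_prod) (simp add: cong_def of_nat_mod)
  also have "(\<Prod>j\<in>B. int (j mod m)) = (\<Prod>j\<in>totatives m. int j)"
    by (rule prod.reindex_bij_betw[OF bij])
  also have "[\<dots> = - 1] (mod int m)"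
    using wilson_prime_power[OF p k] by (simp add: m_def)
  finally have B: "[(\<Prod>j\<in>B. int j) = - 1] (mod int m)" .
  have "morita_gamma_nat p (n + m) = (- 1) ^ (n + m) * ((\<Prod>j\<in>A. int j) * (\<Prod>j\<in>B. int j))"
    unfolding morita_gamma_nat_def un
    by (subst prod.union_disjoint[OF fin]) (auto simp: A_def B_def)
  also have "[\<dots> = (- 1) ^ (n + m) * ((\<Prod>j\<in>A. int j) * - 1)] (mod int m)"
    by (intro cong_mult cong_refl B)
  also have "(- 1) ^ (n + m) * ((\<Prod>j\<in>A. int j) * - 1) = (- 1) ^ n * (\<Prod>j\<in>A. int j)"
    using p by (simp add: power_add m_def)
  also have "\<dots> = morita_gamma_nat p n"
    by (simp add: morita_gamma_nat_def A_def)
  finally show ?thesis by (simp add: m_def)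
qed

lemma morita_gamma_nat_cong:
  fixes p k m n :: nat
  assumes p: "prime p" "odd p" and k: "k > 0" and mn: "[m = n] (mod p ^ k)"
  shows "[morita_gamma_nat p m = morita_gamma_nat p n] (mod int p ^ k)"
proof -
  have *: "[morita_gamma_nat p (r + q * p ^ k) = morita_gamma_nat p r] (mod int p ^ k)" for r q
  proof (induction q)
    case (Suc q)
    have "[morita_gamma_nat p (r + q * p ^ k + p ^ k) = morita_gamma_nat p (r + q * p ^ k)] (mod int p ^ k)"
      by (rule morita_gamma_nat_add[OF p k])
    then show ?case using Suc.IH cong_trans by (simp add: algebra_simps) blast
  qed simp
  have "[morita_gamma_nat p r = morita_gamma_nat p (r mod p ^ k)] (mod int p ^ k)" for r
    using *[of "r mod p ^ k" "r div p ^ k"] unfolding mod_div_mult_eq .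
  then show ?thesis using mn unfolding cong_def by metis
qed

lemma padic_proj_of_int:
  "padic_proj (of_int z :: 'p :: prime_card padic_int) n = z mod int CARD('p) ^ n"
proof (cases z rule: int_cases2)
  case (nonneg k)
  then show ?thesis by (simp add: padic_proj_of_nat)
next
  case (nonpos k)
  then show ?thesis by (simp add: padic_proj_of_nat padic_proj_uminus mod_minus_eq)
qed

lemma padic_dvd_diff_iff:
  "of_nat CARD('p) ^ n dvd (x - y :: 'p :: prime_card padic_int) \<longleftrightarrow> padic_proj x n = padic_proj y n"
proof -
  have "of_nat CARD('p) ^ n dvd (x - y) \<longleftrightarrow> padic_proj x n mod int CARD('p) ^ n = padic_proj y n mod int CARD('p) ^ n"
    unfolding padic_dvd_iff padic_proj_diff mod_eq_dvd_iff dvd_eq_mod_eq_0 ..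
  then show ?thesis unfolding padic_proj_mod_self .
qed

lemma inverse_CARD_power_tendsto:
  "(\<lambda>n. inverse (real CARD('p :: prime_card)) ^ n) \<longlonglongrightarrow> 0"
  using CARD_gt_1[where 'p = 'p] by (intro LIMSEQ_realpow_zero) (auto simp: inverse_less_1_iff)

lemma padic_nat_approx:
  "(\<lambda>n. of_nat (nat (padic_proj x n)) :: 'p :: prime_card padic_int) \<longlonglongrightarrow> x"
proof -
  have "dist (of_nat (nat (padic_proj x n))) x \<le> inverse (real CARD('p)) ^ n" for n
    using padic_proj_bounds[of x n]
    unfolding dist_padic_le_iff padic_dvd_diff_iff padic_proj_of_nat by simp
  then have "(\<lambda>n. dist (of_nat (nat (padic_proj x n))) x) \<longlonglongrightarrow> 0"
    by (intro tendsto_sandwich[OF _ _ tendsto_const inverse_CARD_power_tendsto[where 'p = 'p]]) auto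
  then show ?thesis by (rule iffD2[OF tendsto_dist_iff])
qed

lemma padic_Gamma_ex1:
  assumes "odd CARD('p :: prime_card)"
  shows "\<exists>!g :: 'p padic_int \<Rightarrow> 'p padic_int. continuous_on UNIV g \<and>
    (\<forall>n. g (of_nat n) = of_int (morita_gamma_nat CARD('p) n))"
proof (rule ex_ex1I)
  let ?p = "int CARD('p)" and ?G = "morita_gamma_nat CARD('p)"
  have gc: "?G m mod ?p ^ k = ?G n mod ?p ^ k" if "int m mod ?p ^ k = int n mod ?p ^ k" for m n k
  proof (cases "k = 0")
    case False
    have "[m = n] (mod CARD('p) ^ k)"
      using that by (metis cong_def cong_int_iff of_nat_power)
    then show ?thesis
      using morita_gamma_nat_cong[OF prime_card[where 'a = 'p] assms] False unfolding cong_def by blast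
  qed simp
  define h where "h = (\<lambda>(x :: 'p padic_int) k. ?G (nat (padic_proj x k)))"
  have nn: "int (nat (padic_proj x k)) = padic_proj x k" for x :: "'p padic_int" and k
    using padic_proj_bounds[of x k] by simp
  have "h x (Suc k) mod ?p ^ k = h x k mod ?p ^ k" for x k
    unfolding h_def by (rule gc) (simp only: nn padic_proj_mod[of k "Suc k"] padic_proj_mod_self le_SucI order_refl)
  note compat = compatible_mod[where 'p = 'p, of "h x" for x, OF this]
  define g where "g = (\<lambda>x. Abs_padic_int (\<lambda>k. h x k mod ?p ^ k) :: 'p padic_int)"
  have g: "padic_proj (g x) k = h x k mod ?p ^ k" for x k
    unfolding g_def using compat[of x] by (subst Abs_padic_int_inverse) auto
  have "g (of_nat n) = of_int (?G n)" for n
    unfolding padic_eq_iff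
  proof
    fix k
    have "h (of_nat n) k mod ?p ^ k = ?G n mod ?p ^ k"
      unfolding h_def by (rule gc) (unfold nn, simp only: padic_proj_of_nat mod_mod_trivial)
    then show "padic_proj (g (of_nat n)) k = padic_proj (of_int (?G n) :: 'p padic_int) k"
      unfolding g padic_proj_of_int .
  qed
  moreover have "continuous_on UNIV g"
    unfolding continuous_on_def tendsto_iff eventually_at
  proof (intro ballI allI impI)
    fix x :: "'p padic_int" and e :: real
    assume "e > 0"
    then obtain n where n: "inverse (real CARD('p)) ^ n < e"
      using order_tendstoD(2)[OF inverse_CARD_power_tendsto[where 'p = 'p]]
      by (meson eventually_sequentially order_refl)
    have "dist (g y) (g x) < e" if "dist y x < inverse (real CARD('p)) ^ n" for y
    proof -
      have "padic_proj y n = padic_proj x n"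
        using that dist_padic_le_iff[of y x n] padic_dvd_diff_iff[of n y x] by simp
      then have "padic_proj (g y) n = padic_proj (g x) n"
        unfolding g h_def by simp
      then have "dist (g y) (g x) \<le> inverse (real CARD('p)) ^ n"
        unfolding dist_padic_le_iff padic_dvd_diff_iff .
      then show ?thesis using n by linarith
    qed
    moreover have "inverse (real CARD('p)) ^ n > 0"
      using CARD_gt_1[where 'p = 'p] by simp
    ultimately show "\<exists>d>0. \<forall>x'\<in>UNIV. x' \<noteq> x \<and> dist x' x < d \<longrightarrow> dist (g x') (g x) < e"
      by blast
  qed
  ultimately show "\<exists>g :: 'p padic_int \<Rightarrow> 'p padic_int. continuous_on UNIV g \<and>
      (\<forall>n. g (of_nat n) = of_int (?G n))" by blast
next
  fix f g :: "'p padic_int \<Rightarrow> 'p padic_int"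
  assume f: "continuous_on UNIV f \<and> (\<forall>n. f (of_nat n) = of_int (morita_gamma_nat CARD('p) n))"
    and g: "continuous_on UNIV g \<and> (\<forall>n. g (of_nat n) = of_int (morita_gamma_nat CARD('p) n))"
  show "f = g"
  proof
    fix x :: "'p padic_int"
    let ?s = "\<lambda>n. of_nat (nat (padic_proj x n)) :: 'p padic_int"
    have "(\<lambda>n. h (?s n)) \<longlonglongrightarrow> h x"
      if "continuous_on UNIV h" for h :: "'p padic_int \<Rightarrow> 'p padic_int"
      using continuous_on_tendsto_compose[OF that padic_nat_approx[of x]] by simp
    then have "(\<lambda>n. f (?s n)) \<longlonglongrightarrow> f x" "(\<lambda>n. g (?s n)) \<longlonglongrightarrow> g x"
      using f g by blast+
    moreover have "(\<lambda>n. f (?s n)) = (\<lambda>n. g (?s n))" using f g by simp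
    ultimately show "f x = g x" by (metis LIMSEQ_unique)
  qed
qed

lemma padic_Gamma_continuous:
  assumes "odd CARD('p :: prime_card)"
  shows "continuous_on UNIV (padic_Gamma :: 'p padic_int \<Rightarrow> 'p padic_int)"
  unfolding padic_Gamma_def using theI'[OF padic_Gamma_ex1[OF assms]] by blast

lemma padic_Gamma_of_nat:
  assumes "odd CARD('p :: prime_card)"
  shows "padic_Gamma (of_nat n :: 'p padic_int) = of_int (morita_gamma_nat CARD('p) n)"
  unfolding padic_Gamma_def using theI'[OF padic_Gamma_ex1[OF assms]] by blast

section \<open>The field of p-adic numbers\<close>

instance fract :: ("{idom, ring_char_0}") field_char_0
proof
  show "inj (of_nat :: nat \<Rightarrow> 'a fract)"
    by (rule injI) (simp add: of_nat_fract eq_fract)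
qed

type_synonym 'p padic = "'p padic_int fract"

text \<open>The inclusion of the p-adic integers into their fraction field.\<close>

definition of_padic_int :: "'p :: prime_card padic_int \<Rightarrow> 'p padic"
  where "of_padic_int x = Fract x 1"

text \<open>Congruence modulo p ^ m: the difference lies in p ^ m times the p-adic integers.\<close>

definition padic_cong :: "'p :: prime_card padic \<Rightarrow> 'p padic \<Rightarrow> nat \<Rightarrow> bool"
  where "padic_cong x y m \<longleftrightarrow>
    (\<exists>z. x - y = of_nat CARD('p) ^ m * of_padic_int z)"

section \<open>Truncated hypergeometric series\<close>

definition trunc_hypergeo :: "'a :: field_char_0 list \<Rightarrow> 'a list \<Rightarrow> 'a \<Rightarrow> nat \<Rightarrow> 'a"
  where "trunc_hypergeo as bs z n =
    (\<Sum>k\<le>n. (\<Prod>a\<leftarrow>as. pochhammer a k) / (\<Prod>b\<leftarrow>bs. pochhammer b k) * (z ^ k / fact k))"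

end

theory Submission
  imports Defs "HOL-Computational_Algebra.Formal_Power_Series"
begin

text \<open>
  Write a, b, c, d for the residues of \<open>- \<alpha>\<close>, \<open>- \<beta>\<close>, \<open>- \<gamma>\<close>, \<open>- \<delta>\<close> and put \<open>\<alpha> = p s - a\<close>, \<open>\<beta> = p t - b\<close>,
  \<open>\<gamma> = p u - c\<close>, \<open>\<delta> = p v - d\<close>. The terms with k > d of the left series vanish modulo \<open>p\<^sup>2\<close>, their
  numerators being divisible by \<open>p\<^sup>3\<close> and their denominators by p only; the same holds on the right
  for k > e = p - 1 - b - c + d. After clearing denominators, the difference D of the two sides is
  modulo \<open>p\<^sup>2\<close> a constant plus p times a linear form in (s, t, u, v).

  For a first parameter \<open>- n\<close> the transformation is an exact identity, obtained by comparing
  coefficients in Euler's transformation of \<open>\<^sub>2F\<^sub>1\<close>. Taking n = a gives D = 0 for s = 0 and all t, u, v;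
  taking n = a + p gives D = 0 at (s, t, u, v) = (-1, 0, 1, 1), because there both sums are cut off by
  another parameter. Hence every coefficient of the linear form vanishes modulo p.
\<close>

unbundle fps_syntax

section \<open>Euler's transformation and terminating series\<close>

text \<open>The Gauss series with lower parameter 1: one of the two factorials in the denominator
  stands for \<open>pochhammer 1 k\<close>.\<close>

definition hyp2F1 :: "'a::field_char_0 \<Rightarrow> 'a \<Rightarrow> 'a fps" where
  "hyp2F1 b c = Abs_fps (\<lambda>k. pochhammer b k * pochhammer c k / (fact k)^2)"

text \<open>The expansion of \<open>(1 - X)\<close> to the power \<open>- x\<close>.\<close>

definition neg_binomial :: "'a::field_char_0 \<Rightarrow> 'a fps" where
  "neg_binomial x = Abs_fps (\<lambda>k. pochhammer x k / fact k)"

text \<open>Coefficientwise this is Vandermonde's convolution for rising factorials.\<close>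

lemma neg_binomial_mult: "neg_binomial x * neg_binomial y = neg_binomial (x + y)"
proof (rule fps_ext)
  fix n
  have "pochhammer x i / fact i * (pochhammer y (n - i) / fact (n - i))
      = of_nat (n choose i) * pochhammer x i * pochhammer y (n - i) / fact n" if "i \<le> n" for i
    using that by (simp add: binomial_fact)
  then show "(neg_binomial x * neg_binomial y) $ n = neg_binomial (x + y) $ n"
    by (simp add: neg_binomial_def fps_mult_nth pochhammer_binomial_sum atLeast0AtMost sum_divide_distrib)
qed

lemma neg_binomial_deriv:
  "(1 - fps_X) * fps_deriv (neg_binomial x) = fps_const x * neg_binomial x"
proof (rule fps_ext)
  fix n
  have rec: "of_nat (Suc n) * neg_binomial x $ Suc n = (x + of_nat n) * neg_binomial x $ n" for n
    by (simp add: neg_binomial_def pochhammer_Suc divide_simps del: of_nat_Suc)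
  show "((1 - fps_X) * fps_deriv (neg_binomial x)) $ n = (fps_const x * neg_binomial x) $ n"
    using rec[of n] by (cases n) (simp_all add: left_diff_distrib algebra_simps)
qed

text \<open>
  The hypergeometric equation in the form \<open>D(\<theta> f) = (\<theta> + b) (\<theta> + c) f\<close> with \<open>\<theta> = X D\<close>,
  in which comparing coefficients gives the recurrence at once.
\<close>

definition hyp_ode :: "'a::field_char_0 \<Rightarrow> 'a \<Rightarrow> 'a fps \<Rightarrow> bool" where
  "hyp_ode b c f \<longleftrightarrow> fps_deriv (fps_X * fps_deriv f) = fps_X * fps_deriv (fps_X * fps_deriv f)
     + fps_const (b + c) * (fps_X * fps_deriv f) + fps_const (b * c) * f"

lemma hyp_ode_iff:
  "hyp_ode b c f \<longleftrightarrow> (\<forall>n. (of_nat (Suc n))^2 * f $ Suc n = (b + of_nat n) * (c + of_nat n) * f $ n)"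
proof -
  have "fps_deriv (fps_X * fps_deriv f) $ n = (of_nat (Suc n))^2 * f $ Suc n" for n
    by (simp add: power2_eq_square algebra_simps)
  moreover have "(fps_X * fps_deriv (fps_X * fps_deriv f)
     + fps_const (b + c) * (fps_X * fps_deriv f) + fps_const (b * c) * f) $ n
     = (b + of_nat n) * (c + of_nat n) * f $ n" for n
    by (cases n) (simp_all add: algebra_simps)
  ultimately show ?thesis unfolding hyp_ode_def fps_eq_iff by simp
qed

lemma hyp_ode_hyp2F1: "hyp_ode b c (hyp2F1 b c)"
  unfolding hyp_ode_iff
  by (simp add: hyp2F1_def pochhammer_Suc power2_eq_square divide_simps del: of_nat_Suc)

text \<open>The recurrence of \<open>hyp_ode_iff\<close> has leading factor (n + 1)^2, nonzero in
  characteristic 0, so the constant term determines the series.\<close>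

lemma hyp_ode_unique:
  assumes "hyp_ode b c f" "f $ 0 = 1"
  shows "f = hyp2F1 b c"
proof (rule fps_ext)
  fix n
  show "f $ n = hyp2F1 b c $ n"
  proof (induction n)
    case 0
    show ?case using assms(2) by (simp add: hyp2F1_def)
  next
    case (Suc n)
    have "(of_nat (Suc n))^2 * f $ Suc n = (of_nat (Suc n))^2 * hyp2F1 b c $ Suc n"
      using assms(1) hyp_ode_hyp2F1[of b c] Suc unfolding hyp_ode_iff by metis
    then show ?case by (simp del: of_nat_Suc)
  qed
qed

text \<open>For lower parameter 1 Euler's exponent is 1 - b - c. The product on the right solves the
  hypergeometric equation for b and c and has constant term 1, so uniqueness applies.\<close>

lemma euler_transformation:
  "hyp2F1 b c = neg_binomial (b + c - 1) * hyp2F1 (1 - b) (1 - c)"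
proof -
  let ?k = "b + c - 1" and ?X = "fps_X :: 'a fps"
  define B where "B = neg_binomial ?k"
  define H where "H = hyp2F1 (1 - b) (1 - c)"
  define k where "k = fps_const ?k"
  define q where "q = fps_const (b * c)"
  \<comment> \<open>The equations for (b, c) and for (1 - b, 1 - c) are both expressed through k and
    q; what remains is a polynomial identity.\<close>
  have c1: "fps_const (b + c) = k + 1"
    by (rule fps_ext) (simp add: k_def)
  have c2: "fps_const (1 - b + (1 - c)) = 1 - k"
    by (rule fps_ext) (simp add: k_def)
  have c3: "fps_const ((1 - b) * (1 - c)) = q - k"
    by (rule fps_ext) (simp add: k_def q_def algebra_simps)
  define B1 where "B1 = fps_deriv B"
  define B2 where "B2 = fps_deriv B1"
  define H1 where "H1 = fps_deriv H"
  define H2 where "H2 = fps_deriv H1"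
  have b1: "(1 - ?X) * B1 = k * B"
    using neg_binomial_deriv[of ?k] by (simp add: B_def B1_def k_def)
  have "fps_deriv ((1 - ?X) * B1) = fps_deriv (k * B)" by (simp only: b1)
  then have b2: "(1 - ?X) * B2 = (k + 1) * B1"
    by (simp add: k_def B2_def B1_def[symmetric] algebra_simps)
  have h: "?X * H2 + H1 = ?X * (?X * H2 + H1) + (1 - k) * (?X * H1) + (q - k) * H"
    using hyp_ode_hyp2F1[of "1 - b" "1 - c"] unfolding hyp_ode_def c2 c3
    by (simp add: H_def[symmetric] H1_def[symmetric] H2_def[symmetric] algebra_simps)
  have g1: "fps_deriv (B * H) = B * H1 + B1 * H"
    by (simp add: B1_def H1_def)
  have g2: "fps_deriv (?X * fps_deriv (B * H))
      = B * H1 + B1 * H + ?X * (B * H2 + B1 * H1 + B1 * H1 + B2 * H)"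
    unfolding g1 by (simp add: B1_def[symmetric] H1_def[symmetric] B2_def[symmetric] H2_def[symmetric] algebra_simps)
  \<comment> \<open>Multiplied by 1 - X, the amount by which the product fails its equation is a
    combination of the corresponding amounts for \<open>h\<close>, \<open>b1\<close> and
    \<open>b2\<close>, all of which are 0.\<close>
  have "(1 - ?X) * ((B * H1 + B1 * H + ?X * (B * H2 + B1 * H1 + B1 * H1 + B2 * H))
     - (?X * (B * H1 + B1 * H + ?X * (B * H2 + B1 * H1 + B1 * H1 + B2 * H))
     + (k + 1) * (?X * (B * H1 + B1 * H)) + q * (B * H)))
     = (1 - ?X) * B * ((?X * H2 + H1) - (?X * (?X * H2 + H1) + (1 - k) * (?X * H1) + (q - k) * H))
      + ((1 - ?X) * H + 2 * (1 - ?X) * ?X * H1) * ((1 - ?X) * B1 - k * B)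
      + ?X * (1 - ?X) * H * ((1 - ?X) * B2 - (k + 1) * B1)"
    by (simp add: algebra_simps)
  then have "(1 - ?X) * ((B * H1 + B1 * H + ?X * (B * H2 + B1 * H1 + B1 * H1 + B2 * H))
     - (?X * (B * H1 + B1 * H + ?X * (B * H2 + B1 * H1 + B1 * H1 + B2 * H))
     + (k + 1) * (?X * (B * H1 + B1 * H)) + q * (B * H))) = 0"
    using b1 b2 h by simp
  moreover have "1 - ?X \<noteq> 0"
  proof
    assume "1 - ?X = 0"
    then have "(1 - ?X) $ 0 = 0" by simp
    then show False by simp
  qed
  ultimately have "hyp_ode b c (B * H)"
    unfolding hyp_ode_def g2 c1 q_def[symmetric] unfolding g1 by simp
  moreover have "(B * H) $ 0 = 1"
    by (simp add: B_def H_def neg_binomial_def hyp2F1_def)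
  ultimately show ?thesis
    using hyp_ode_unique B_def H_def by metis
qed

text \<open>
  The truncation at n of the series with upper parameters a, b, c and lower parameters 1, d,
  multiplied by \<open>pochhammer d n * (fact n)\<^sup>2\<close> so that it is a polynomial in a, b, c, d.
\<close>

definition hyp3F2 :: "nat \<Rightarrow> 'a::comm_ring_1 \<Rightarrow> 'a \<Rightarrow> 'a \<Rightarrow> 'a \<Rightarrow> 'a" where
  "hyp3F2 n a b c d = (\<Sum>k\<le>n. pochhammer a k * pochhammer b k * pochhammer c k
     * pochhammer (d + of_nat k) (n - k) * (pochhammer (1 + of_nat k) (n - k))^2)"

text \<open>The factors on the left are the negatives of those on the right, in reverse
  order.\<close>

lemma pochhammer_complement: "pochhammer (1 - d - of_nat n) (n - k) =
    (-1) ^ (n - k) * pochhammer (d + of_nat k) (n - k)" if "k \<le> n" for d :: "'a::comm_ring_1"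
  using pochhammer_minus[of "d + of_nat n - 1" "n - k"] that
  by (simp add: of_nat_diff algebra_simps)

lemma fact_split: "k \<le> n \<Longrightarrow> (fact n :: 'a::{comm_semiring_1,semiring_char_0}) = fact k * pochhammer (1 + of_nat k) (n - k)"
  by (simp add: pochhammer_fact pochhammer_product)

text \<open>By \<open>pochhammer_complement\<close> the sum becomes a Cauchy product. Of the three
  factorials, one comes from (-n)_k = (-1)^k n! / (n - k)! and two from the normalising factor of
  \<open>hyp3F2\<close>.\<close>

lemma hyp3F2_eq_coeff:
  fixes b c d :: "'a::field_char_0"
  shows "hyp3F2 n (- of_nat n) b c d
    = (-1) ^ n * (fact n) ^ 3 * (hyp2F1 b c * neg_binomial (1 - d - of_nat n)) $ n"
proof -
  have "pochhammer (- of_nat n) k * pochhammer b k * pochhammer c k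
     * pochhammer (d + of_nat k) (n - k) * (pochhammer (1 + of_nat k) (n - k))^2
     = (-1) ^ n * (fact n) ^ 3 * (pochhammer b k * pochhammer c k / (fact k)^2 *
        (pochhammer (1 - d - of_nat n) (n - k) / fact (n - k)))" if k: "k \<le> n" for k
  proof -
    have 1: "pochhammer (- of_nat n) k * fact (n - k) = (-1) ^ k * (fact n :: 'a)"
      using k fact_split[of "n - k" n, where 'a = 'a]
      by (simp add: pochhammer_minus of_nat_diff algebra_simps)
    have 2: "(-1) ^ n = (-1 :: 'a) ^ k * (-1) ^ (n - k)"
      using k by (simp flip: power_add)
    have 3: "(-1 :: 'a) ^ (n - k) * (-1) ^ (n - k) = 1"
      by (simp flip: power_mult_distrib)
    have 4: "pochhammer (- of_nat n) k = (-1) ^ k * (fact n :: 'a) / fact (n - k)"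
      using 1 by (simp add: field_simps)
    have 5: "(fact n :: 'a) ^ 3 / (fact k)^2 = fact n * (pochhammer (1 + of_nat k) (n - k))^2"
      unfolding fact_split[OF k, where 'a = 'a] by (simp add: power2_eq_square power3_eq_cube)
    have "(-1) ^ n * (fact n) ^ 3 * (pochhammer b k * pochhammer c k / (fact k)^2 *
        (pochhammer (1 - d - of_nat n) (n - k) / fact (n - k)))
      = (-1) ^ k * ((-1) ^ (n - k) * (-1) ^ (n - k)) * ((fact n) ^ 3 / (fact k)^2) * pochhammer b k
        * pochhammer c k * pochhammer (d + of_nat k) (n - k) / fact (n - k)"
      unfolding pochhammer_complement[OF k] 2 by (simp add: mult_ac)
    also have "\<dots> = pochhammer (- of_nat n) k * pochhammer b k * pochhammer c k
     * pochhammer (d + of_nat k) (n - k) * (pochhammer (1 + of_nat k) (n - k))^2"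
      unfolding 3 4 5 by (simp add: mult_ac)
    finally show ?thesis ..
  qed
  then show ?thesis
    by (simp add: hyp3F2_def hyp2F1_def neg_binomial_def fps_mult_nth atLeast0AtMost sum_distrib_left)
qed

text \<open>Euler's transformation contributes a further power of 1 - X. Adding the two exponents
  gives a factor of the same shape with d replaced by 1 + d - b - c.\<close>

lemma hyp3F2_transform_field:
  fixes b c d :: "'a::field_char_0"
  shows "hyp3F2 n (- of_nat n) b c d = hyp3F2 n (- of_nat n) (1 - b) (1 - c) (1 + d - b - c)"
proof -
  have "hyp2F1 b c * neg_binomial (1 - d - of_nat n)
    = hyp2F1 (1 - b) (1 - c) * (neg_binomial (b + c - 1) * neg_binomial (1 - d - of_nat n))"
    unfolding euler_transformation[of b c] by (simp only: mult_ac)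
  also have "neg_binomial (b + c - 1) * neg_binomial (1 - d - of_nat n)
     = neg_binomial (1 - (1 + d - b - c) - of_nat n)"
    unfolding neg_binomial_mult by (simp add: algebra_simps)
  finally show ?thesis unfolding hyp3F2_eq_coeff by simp
qed

lemma hyp3F2_hom:
  fixes h :: "'a::comm_ring_1 \<Rightarrow> 'b::comm_ring_1"
  assumes "h 1 = 1" "\<And>x y. h (x + y) = h x + h y" "\<And>x y. h (x * y) = h x * h y"
  shows "h (hyp3F2 n a b c d) = hyp3F2 n (h a) (h b) (h c) (h d)"
proof -
  have 0: "h 0 = 0" using assms(2)[of 0 0] by simp
  have nat: "h (of_nat k) = of_nat k" for k
    by (induction k) (simp_all add: assms 0)
  have poch: "h (pochhammer x k) = pochhammer (h x) k" for x k
    by (induction k) (simp_all add: assms nat pochhammer_Suc)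
  have sum: "h (sum f A) = (\<Sum>x\<in>A. h (f x))" for f :: "nat \<Rightarrow> 'a" and A
    by (induction A rule: infinite_finite_induct) (simp_all add: assms 0)
  show ?thesis
    unfolding hyp3F2_def sum power2_eq_square by (simp add: assms poch nat)
qed

text \<open>Both sides are polynomials in the parameters, so the identity descends from the fraction
  field; it is needed for p-adic integers.\<close>

lemma hyp3F2_transform:
  fixes b c d :: "'a::{idom,ring_char_0}"
  shows "hyp3F2 n (- of_nat n) b c d = hyp3F2 n (- of_nat n) (1 - b) (1 - c) (1 + d - b - c)"
proof -
  define h where "h = (\<lambda>x::'a. Fract x 1)"
  have hom: "h 1 = 1" "\<And>x y. h (x + y) = h x + h y" "\<And>x y. h (x * y) = h x * h y"
    by (simp_all add: h_def One_fract_def)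
  have diff: "h (x - y) = h x - h y" for x y
    by (simp add: h_def)
  have neg: "h (- of_nat n) = - of_nat n"
    by (simp add: h_def of_nat_fract)
  have "h (hyp3F2 n (- of_nat n) b c d)
      = h (hyp3F2 n (- of_nat n) (1 - b) (1 - c) (1 + d - b - c))"
    unfolding hyp3F2_hom[of h, OF hom] hom diff neg by (rule hyp3F2_transform_field)
  then show ?thesis by (simp add: h_def eq_fract)
qed

text \<open>Both truncations contain all nonzero terms and differ only in their normalising factors.
  Cross multiplication avoids dividing by symbols that may vanish.\<close>

lemma hyp3F2_terminating:
  fixes a b c d :: "'a::{idom,ring_char_0}"
  assumes "r \<le> n" and "\<And>k. k > r \<Longrightarrow> pochhammer a k * pochhammer b k * pochhammer c k = 0"
  shows "hyp3F2 n a b c d * (pochhammer d r * (fact r)^2)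
    = hyp3F2 r a b c d * (pochhammer d n * (fact n)^2)"
proof -
  have "hyp3F2 n a b c d = (\<Sum>k\<le>r. pochhammer a k * pochhammer b k * pochhammer c k
     * pochhammer (d + of_nat k) (n - k) * (pochhammer (1 + of_nat k) (n - k))^2)"
    unfolding hyp3F2_def using assms by (intro sum.mono_neutral_right) auto
  also have "\<dots> = hyp3F2 r a b c d * (pochhammer (d + of_nat r) (n - r) * (pochhammer (1 + of_nat r) (n - r))^2)"
    unfolding hyp3F2_def sum_distrib_right
  proof (intro sum.cong refl)
    fix k assume "k \<in> {..r}"
    then have "pochhammer (x + of_nat k) (n - k) = pochhammer (x + of_nat k) (r - k) * pochhammer (x + of_nat r) (n - r)" for x :: 'a
      using pochhammer_product[of "r - k" "n - k" "x + of_nat k"] assms(1) by (simp add: of_nat_diff)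
    then show "pochhammer a k * pochhammer b k * pochhammer c k
     * pochhammer (d + of_nat k) (n - k) * (pochhammer (1 + of_nat k) (n - k))^2
     = pochhammer a k * pochhammer b k * pochhammer c k
     * pochhammer (d + of_nat k) (r - k) * (pochhammer (1 + of_nat k) (r - k))^2 *
     (pochhammer (d + of_nat r) (n - r) * (pochhammer (1 + of_nat r) (n - r))^2)"
      by (simp add: power_mult_distrib mult_ac)
  qed
  finally show ?thesis
    using pochhammer_product[OF assms(1), of d] fact_split[OF assms(1), where 'a = 'a]
    by (simp add: power_mult_distrib mult_ac)
qed

text \<open>Both orders of m and n occur later: n = a lies below the truncation points, n = p + a
  above them.\<close>

lemma hyp3F2_terminating_cross:
  fixes a b c d :: "'a::{idom,ring_char_0}"
  assumes "\<And>k. k > min m n \<Longrightarrow> pochhammer a k * pochhammer b k * pochhammer c k = 0"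
  shows "hyp3F2 n a b c d * (pochhammer d m * (fact m)^2)
    = hyp3F2 m a b c d * (pochhammer d n * (fact n)^2)"
  using hyp3F2_terminating[of m n a b c d] hyp3F2_terminating[of n m a b c d] assms(1)
  by (cases "m \<le> n") (auto simp: min_def)

section \<open>The p-adic gamma function\<close>

lemma padic_eqI:
  "x = y" if "\<And>k. k > 0 \<Longrightarrow> of_nat CARD('p) ^ k dvd x - (y :: 'p :: prime_card padic_int)"
proof -
  have "padic_proj x k = padic_proj y k" for k
    using that[of k] padic_dvd_diff_iff[of k x y] by (cases "k = 0") auto
  then show ?thesis unfolding padic_eq_iff by blast
qed

lemma padic_dvd_of_int_iff:
  "of_nat CARD('p) ^ k dvd (of_int z :: 'p :: prime_card padic_int) \<longleftrightarrow> int CARD('p) ^ k dvd z"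
  unfolding padic_dvd_iff padic_proj_of_int by (simp add: dvd_eq_mod_eq_0)

lemma padic_CARD_dvd_of_int_iff:
  "of_nat CARD('p) dvd (of_int z :: 'p :: prime_card padic_int) \<longleftrightarrow> int CARD('p) dvd z"
  using padic_dvd_of_int_iff[of 1 z] by simp

lemma padic_prime_elem: "prime_elem (of_nat CARD('p) :: 'p :: prime_card padic_int)"
proof (rule prime_elemI)
  show "of_nat CARD('p) \<noteq> (0 :: 'p padic_int)"
    using CARD_gt_1[where 'p = 'p] by simp
  show "\<not> of_nat CARD('p) dvd (1 :: 'p padic_int)"
    using padic_CARD_dvd_of_int_iff[of 1, where 'p = 'p] CARD_gt_1[where 'p = 'p] by simp
next
  fix x y :: "'p padic_int"
  assume "of_nat CARD('p) dvd x * y"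
  then have "int CARD('p) dvd padic_proj x 1 * padic_proj y 1"
    using padic_dvd_iff[of 1 "x * y"] by (simp add: padic_proj_mult dvd_eq_mod_eq_0)
  then have "int CARD('p) dvd padic_proj x 1 \<or> int CARD('p) dvd padic_proj y 1"
    using prime_dvd_mult_iff[OF prime_CARD[where 'p = 'p]] by blast
  then show "of_nat CARD('p) dvd x \<or> of_nat CARD('p) dvd y"
    using padic_dvd_iff[of 1 x] padic_dvd_iff[of 1 y] padic_proj_mod_self[of x 1] padic_proj_mod_self[of y 1]
    by (auto simp: dvd_eq_mod_eq_0)
qed

text \<open>The components are invertible modulo every p^n; inverses modulo p^n are unique, so they
  are compatible and define a p-adic integer.\<close>

lemma padic_unit:
  fixes x :: "'p :: prime_card padic_int"
  assumes "\<not> of_nat CARD('p) dvd x"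
  shows "x dvd 1"
proof -
  let ?p = "int CARD('p)"
  have "\<not> ?p dvd padic_proj x n" if "n > 0" for n
  proof
    assume "?p dvd padic_proj x n"
    then have "padic_proj x n mod ?p ^ 1 = 0" by simp
    then have "padic_proj x 1 = 0"
      using padic_proj_mod[of 1 n x] that by simp
    then show False using assms padic_dvd_iff[of 1 x] by simp
  qed
  then have "coprime (padic_proj x n) (?p ^ n)" for n
    using prime_imp_coprime[OF prime_CARD[where 'p = 'p], of "padic_proj x n"]
    by (cases "n = 0") (auto simp: coprime_commute)
  then have "\<exists>y. [padic_proj x n * y = 1] (mod ?p ^ n)" for n
    using coprime_iff_invertible_int by blast
  then obtain h where h: "\<And>n. [padic_proj x n * h n = 1] (mod ?p ^ n)"
    by metis
  have "h (Suc n) mod ?p ^ n = h n mod ?p ^ n" for n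
  proof -
    have "[padic_proj x (Suc n) = padic_proj x n] (mod ?p ^ n)"
      using padic_proj_mod[of n "Suc n" x] by (simp add: cong_def)
    then have "[padic_proj x (Suc n) * h (Suc n) = padic_proj x n * h (Suc n)] (mod ?p ^ n)"
      by (rule cong_scalar_right)
    moreover have "[padic_proj x (Suc n) * h (Suc n) = 1] (mod ?p ^ n)"
      using h[of "Suc n"] by (rule cong_dvd_modulus) simp
    ultimately have 1: "[padic_proj x n * h (Suc n) = 1] (mod ?p ^ n)"
      using cong_sym cong_trans by blast
    have "[h (Suc n) * (padic_proj x n * h n) = h (Suc n) * 1] (mod ?p ^ n)"
      by (rule cong_scalar_left[OF h])
    moreover have "[h n * (padic_proj x n * h (Suc n)) = h n * 1] (mod ?p ^ n)"
      by (rule cong_scalar_left[OF 1])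
    ultimately show ?thesis by (simp add: cong_def mult_ac)
  qed
  note compat = compatible_mod[where 'p = 'p, of h, OF this]
  define y where "y = (Abs_padic_int (\<lambda>k. h k mod ?p ^ k) :: 'p padic_int)"
  have y: "padic_proj y k = h k mod ?p ^ k" for k
    unfolding y_def using compat by (subst Abs_padic_int_inverse) auto
  have "1 = x * y"
    unfolding padic_eq_iff padic_proj_mult padic_proj_one y
    using h by (simp add: cong_def mod_mult_right_eq)
  then show ?thesis by (rule dvdI)
qed

lemma padic_nat_cong_ex:
  "\<exists>n. of_nat CARD('p) ^ k dvd (x :: 'p :: prime_card padic_int) - of_nat n"
proof
  show "of_nat CARD('p) ^ k dvd x - of_nat (nat (padic_proj x k))"
    using padic_proj_bounds[of x k] unfolding padic_dvd_diff_iff padic_proj_of_nat by simp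
qed

lemma dvd_diff_trans:
  fixes m x y z :: "'a :: comm_ring_1"
  assumes "m dvd x - y" "m dvd y - z"
  shows "m dvd x - z"
  using dvd_add[OF assms] by simp

lemma dvd_diff_sym: "m dvd x - y \<Longrightarrow> m dvd y - (x :: 'a :: comm_ring_1)"
  using dvd_minus_iff[of m "x - y"] by simp

lemma dvd_diff_mult:
  fixes m x y u v :: "'a :: comm_ring_1"
  assumes "m dvd x - y" "m dvd u - v"
  shows "m dvd x * u - y * v"
proof -
  have "x * u - y * v = (x - y) * u + y * (u - v)" by (simp add: algebra_simps)
  then show ?thesis using assms by simp
qed

text \<open>By continuity some natural number m is so close to x that the gamma values agree modulo
  p^k as well; then \<open>morita_gamma_nat_cong\<close> compares m with n.\<close>

lemma padic_Gamma_cong_nat: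
  fixes x :: "'p :: prime_card padic_int"
  assumes p: "odd CARD('p)" and n: "of_nat CARD('p) ^ k dvd x - of_nat n"
  shows "of_nat CARD('p) ^ k dvd padic_Gamma x - of_int (morita_gamma_nat CARD('p) n)"
proof (cases "k = 0")
  case False
  let ?s = "\<lambda>n. of_nat (nat (padic_proj x n)) :: 'p padic_int"
  have e: "inverse (real CARD('p)) ^ k > 0"
    using CARD_gt_1[where 'p = 'p] by simp
  have "(\<lambda>n. padic_Gamma (?s n)) \<longlonglongrightarrow> padic_Gamma x"
    using continuous_on_tendsto_compose[OF padic_Gamma_continuous[OF p] padic_nat_approx[of x]] by simp
  then have "eventually (\<lambda>n. dist (padic_Gamma (?s n)) (padic_Gamma x) < inverse (real CARD('p)) ^ k) sequentially"
    using e unfolding tendsto_iff by blast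
  moreover have "eventually (\<lambda>n. dist (?s n) x < inverse (real CARD('p)) ^ k) sequentially"
    using padic_nat_approx[of x] e unfolding tendsto_iff by blast
  ultimately have "eventually (\<lambda>n. dist (padic_Gamma (?s n)) (padic_Gamma x) < inverse (real CARD('p)) ^ k
      \<and> dist (?s n) x < inverse (real CARD('p)) ^ k) sequentially"
    by (rule eventually_conj)
  then obtain N where N: "dist (padic_Gamma (?s N)) (padic_Gamma x) < inverse (real CARD('p)) ^ k"
      "dist (?s N) x < inverse (real CARD('p)) ^ k"
    unfolding eventually_sequentially by blast
  define m where "m = nat (padic_proj x N)"
  have 1: "of_nat CARD('p) ^ k dvd of_int (morita_gamma_nat CARD('p) m) - padic_Gamma x"
    using N(1) dist_padic_le_iff[of _ "padic_Gamma x" k] padic_Gamma_of_nat[OF p, of m]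
    unfolding m_def by (metis less_imp_le)
  have "of_nat CARD('p) ^ k dvd of_nat m - x"
    using N(2) dist_padic_le_iff[of _ x k] unfolding m_def by (metis less_imp_le)
  then have "of_nat CARD('p) ^ k dvd (of_nat m :: 'p padic_int) - of_nat n"
    using n dvd_diff_trans by blast
  then have "[m = n] (mod CARD('p) ^ k)"
    unfolding padic_dvd_diff_iff padic_proj_of_nat
    by (metis cong_def of_nat_eq_iff of_nat_mod of_nat_power)
  then have "[morita_gamma_nat CARD('p) m = morita_gamma_nat CARD('p) n] (mod int CARD('p) ^ k)"
    using morita_gamma_nat_cong[OF prime_card p] False by blast
  then have "of_nat CARD('p) ^ k dvd (of_int (morita_gamma_nat CARD('p) m) :: 'p padic_int)
      - of_int (morita_gamma_nat CARD('p) n)"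
    unfolding of_int_diff[symmetric] padic_dvd_of_int_iff by (simp add: cong_iff_dvd_diff)
  then show ?thesis using 1 dvd_diff_sym dvd_diff_trans by blast
qed simp

lemma padic_Gamma_cong:
  fixes x y :: "'p :: prime_card padic_int"
  assumes p: "odd CARD('p)" and "of_nat CARD('p) ^ k dvd x - y"
  shows "of_nat CARD('p) ^ k dvd padic_Gamma x - padic_Gamma y"
proof -
  obtain n where n: "of_nat CARD('p) ^ k dvd y - of_nat n"
    using padic_nat_cong_ex by blast
  then have "of_nat CARD('p) ^ k dvd x - of_nat n"
    using assms(2) dvd_diff_trans by blast
  then show ?thesis
    using padic_Gamma_cong_nat[OF p n] padic_Gamma_cong_nat[OF p, of k x n] dvd_diff_sym dvd_diff_trans
    by blast
qed

lemma morita_gamma_nat_Suc: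
  "morita_gamma_nat p (Suc n) = (if p dvd n then - 1 else - int n) * morita_gamma_nat p n"
proof (cases "p dvd n")
  case True
  then have "{j. 1 \<le> j \<and> j < Suc n \<and> \<not> p dvd j} = {j. 1 \<le> j \<and> j < n \<and> \<not> p dvd j}"
    by (auto simp: less_Suc_eq)
  then show ?thesis using True by (simp add: morita_gamma_nat_def)
next
  case False
  then have "n \<ge> 1" by (cases n) auto
  then have "{j. 1 \<le> j \<and> j < Suc n \<and> \<not> p dvd j} = insert n {j. 1 \<le> j \<and> j < n \<and> \<not> p dvd j}"
    using False by (auto simp: less_Suc_eq)
  then show ?thesis using False by (simp add: morita_gamma_nat_def)
qed

text \<open>The functional equation is checked modulo each p^k at a natural number near x. Since k >
  0, that number is divisible by p exactly if x is.\<close>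

lemma padic_Gamma_plus_1:
  fixes x :: "'p :: prime_card padic_int"
  assumes p: "odd CARD('p)"
  shows "padic_Gamma (x + 1) = (if of_nat CARD('p) dvd x then - 1 else - x) * padic_Gamma x"
proof (rule padic_eqI)
  fix k :: nat assume k: "k > 0"
  let ?P = "of_nat CARD('p) :: 'p padic_int"
  obtain n where n: "?P ^ k dvd x - of_nat n"
    using padic_nat_cong_ex by blast
  have "?P dvd x - of_nat n"
    using n k by (meson dvd_power dvd_trans)
  then have "?P dvd x \<longleftrightarrow> ?P dvd of_nat n"
    using dvd_add_right_iff[of ?P "x - of_nat n" "of_nat n"] by simp
  then have iff: "?P dvd x \<longleftrightarrow> CARD('p) dvd n"
    using padic_CARD_dvd_of_int_iff[of "int n", where 'p = 'p] by simp
  have "?P ^ k dvd x + 1 - of_nat (Suc n)" using n by simp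
  then have "?P ^ k dvd padic_Gamma (x + 1) - of_int (morita_gamma_nat CARD('p) (Suc n))"
    by (rule padic_Gamma_cong_nat[OF p])
  moreover have "?P ^ k dvd (if of_nat CARD('p) dvd x then - 1 else - x) * padic_Gamma x
     - of_int (morita_gamma_nat CARD('p) (Suc n))"
    unfolding morita_gamma_nat_Suc of_int_mult
    using padic_Gamma_cong_nat[OF p n] dvd_diff_sym[OF n] iff by (intro dvd_diff_mult) auto
  ultimately show "?P ^ k dvd padic_Gamma (x + 1) - (if of_nat CARD('p) dvd x then - 1 else - x) * padic_Gamma x"
    using dvd_diff_sym dvd_diff_trans by blast
qed

text \<open>Modulo p the value is, up to sign, a product of integers prime to p.\<close>

lemma padic_Gamma_not_dvd:
  fixes x :: "'p :: prime_card padic_int"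
  assumes p: "odd CARD('p)"
  shows "\<not> of_nat CARD('p) dvd padic_Gamma x"
proof
  assume *: "of_nat CARD('p) dvd padic_Gamma x"
  obtain n where n: "of_nat CARD('p) ^ 1 dvd x - of_nat n"
    using padic_nat_cong_ex by blast
  have "of_nat CARD('p) dvd (of_int (morita_gamma_nat CARD('p) n) :: 'p padic_int)"
    using padic_Gamma_cong_nat[OF p n] * by (simp add: dvd_diff_right_iff)
  then have "int CARD('p) dvd morita_gamma_nat CARD('p) n"
    using padic_CARD_dvd_of_int_iff by blast
  then have "int CARD('p) dvd (\<Prod>j | 1 \<le> j \<and> j < n \<and> \<not> CARD('p) dvd j. int j)" (is "_ dvd prod int ?A")
    by (cases "even n") (simp_all add: morita_gamma_nat_def)
  moreover have "finite ?A" by simp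
  ultimately show False
    using prime_dvd_prod_iff[OF _ prime_CARD[where 'p = 'p], of ?A int] by auto
qed

lemma padic_Gamma_shift:
  fixes x :: "'p :: prime_card padic_int"
  assumes p: "odd CARD('p)" and "\<And>i. i < n \<Longrightarrow> \<not> of_nat CARD('p) dvd x + of_nat i"
  shows "padic_Gamma (x + of_nat n) = (- 1) ^ n * pochhammer x n * padic_Gamma x"
  using assms(2)
proof (induction n)
  case (Suc n)
  then show ?case
    using padic_Gamma_plus_1[OF p, of "x + of_nat n"] by (simp add: pochhammer_Suc algebra_simps)
qed simp

section \<open>Expansions to first order\<close>

text \<open>The coordinates 0 to 3 stand for s, t, u, v in the idea above. The constant and the
  linear form are the same for all points x.\<close>

definition first_order :: "((nat \<Rightarrow> 'p :: prime_card padic_int) \<Rightarrow> 'p padic_int) \<Rightarrow> bool" where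
  "first_order f \<longleftrightarrow> (\<exists>c l. \<forall>x. of_nat CARD('p) ^ 2 dvd
     f x - (c + of_nat CARD('p) * (\<Sum>i<4. l i * x i)))"

lemma first_orderI:
  fixes f :: "(nat \<Rightarrow> 'p :: prime_card padic_int) \<Rightarrow> 'p padic_int"
  assumes "\<And>x. of_nat CARD('p) ^ 2 dvd f x - (c + of_nat CARD('p) * (\<Sum>i<4. l i * x i))"
  shows "first_order f"
  using assms unfolding first_order_def by blast

lemma first_order_cong:
  fixes f :: "(nat \<Rightarrow> 'p :: prime_card padic_int) \<Rightarrow> 'p padic_int"
  assumes "first_order f" "\<And>x. of_nat CARD('p) ^ 2 dvd g x - f x"
  shows "first_order g"
  using assms dvd_diff_trans unfolding first_order_def by meson

lemma first_order_const: "first_order (\<lambda>x. c)"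
  by (rule first_orderI[of _ c "\<lambda>_. 0"]) simp

lemma first_order_coord:
  assumes "i < 4"
  shows "first_order (\<lambda>x :: nat \<Rightarrow> 'p :: prime_card padic_int. of_nat CARD('p) * x i)"
proof (rule first_orderI[of _ 0 "\<lambda>j. if j = i then 1 else 0"])
  fix x :: "nat \<Rightarrow> 'p padic_int"
  have "(\<Sum>j<4. (if j = i then 1 else 0) * x j) = x i"
    using assms by (simp add: if_distrib[of "\<lambda>y. y * _"] sum.delta cong: if_cong)
  then show "of_nat CARD('p) ^ 2 dvd of_nat CARD('p) * x i
      - (0 + of_nat CARD('p) * (\<Sum>j<4. (if j = i then 1 else 0) * x j))"
    by simp
qed

lemma first_order_add:
  assumes "first_order f" "first_order g"
  shows "first_order (\<lambda>x. f x + g x)"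
proof -
  obtain c l where f: "\<And>x. of_nat CARD('a) ^ 2 dvd f x - (c + of_nat CARD('a) * (\<Sum>i<4. l i * x i))"
    using assms(1) unfolding first_order_def by blast
  obtain c' l' where g: "\<And>x. of_nat CARD('a) ^ 2 dvd g x - (c' + of_nat CARD('a) * (\<Sum>i<4. l' i * x i))"
    using assms(2) unfolding first_order_def by blast
  show ?thesis
  proof (rule first_orderI)
    fix x
    show "of_nat CARD('a) ^ 2 dvd f x + g x - (c + c' + of_nat CARD('a) * (\<Sum>i<4. (l i + l' i) * x i))"
      using dvd_add[OF f[of x] g[of x]] by (simp add: algebra_simps sum.distrib)
  qed
qed

text \<open>The product of the two linear parts carries p^2, so only the cross terms with the
  constants survive.\<close>

lemma first_order_mult:
  assumes "first_order f" "first_order g"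
  shows "first_order (\<lambda>x. f x * g x)"
proof -
  let ?P = "of_nat CARD('a) :: 'a padic_int"
  obtain c l where f: "\<And>x. ?P ^ 2 dvd f x - (c + ?P * (\<Sum>i<4. l i * x i))"
    using assms(1) unfolding first_order_def by blast
  obtain c' l' where g: "\<And>x. ?P ^ 2 dvd g x - (c' + ?P * (\<Sum>i<4. l' i * x i))"
    using assms(2) unfolding first_order_def by blast
  show ?thesis
  proof (rule first_orderI)
    fix x
    let ?l = "\<Sum>i<4. l i * x i" and ?l' = "\<Sum>i<4. l' i * x i"
    have "(\<Sum>i<4. (c * l' i + c' * l i) * x i) = c * ?l' + c' * ?l"
      by (simp add: sum_distrib_left sum.distrib distrib_right mult.assoc)
    then have "(c + ?P * ?l) * (c' + ?P * ?l') - (c * c' + ?P * (\<Sum>i<4. (c * l' i + c' * l i) * x i))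
      = ?P ^ 2 * (?l * ?l')"
      by (simp add: algebra_simps power2_eq_square)
    then have "?P ^ 2 dvd (c + ?P * ?l) * (c' + ?P * ?l')
        - (c * c' + ?P * (\<Sum>i<4. (c * l' i + c' * l i) * x i))"
      by simp
    then show "?P ^ 2 dvd f x * g x - (c * c' + ?P * (\<Sum>i<4. (c * l' i + c' * l i) * x i))"
      using dvd_diff_mult[OF f[of x] g[of x]] dvd_diff_trans by blast
  qed
qed

lemma first_order_diff:
  assumes "first_order f" "first_order g"
  shows "first_order (\<lambda>x. f x - g x)"
  using first_order_add[OF assms(1) first_order_mult[OF first_order_const[of "-1"] assms(2)]] by simp

lemma first_order_sum:
  "(\<And>k. k \<in> A \<Longrightarrow> first_order (f k)) \<Longrightarrow> first_order (\<lambda>x. \<Sum>k\<in>A. f k x)"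
  by (induction A rule: infinite_finite_induct) (auto intro!: first_order_const first_order_add)

lemma first_order_power: "first_order f \<Longrightarrow> first_order (\<lambda>x. f x ^ n)"
  by (induction n) (auto intro!: first_order_const first_order_mult)

lemma first_order_pochhammer: "first_order f \<Longrightarrow> first_order (\<lambda>x. pochhammer (f x) n)"
  by (induction n) (auto simp: pochhammer_Suc intro!: first_order_const first_order_mult first_order_add)

lemmas first_order_intros = first_order_const first_order_coord first_order_add first_order_diff
  first_order_mult first_order_power first_order_pochhammer first_order_sum

section \<open>Morita's function to first order\<close>

text \<open>
  The product of (X + i) over 0 < i < p is invariant under replacing X by -p - X; comparing X = 0
  with X = -p, its linear coefficient vanishes modulo p.
\<close>

lemma pochhammer_CARD_minus_1_cong:
  fixes s :: "'p :: prime_card padic_int"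
  assumes p: "odd CARD('p)"
  shows "of_nat CARD('p) ^ 2 dvd
    pochhammer (1 + of_nat CARD('p) * s) (CARD('p) - 1) - fact (CARD('p) - 1)"
proof -
  let ?P = "of_nat CARD('p) :: 'p padic_int" and ?n = "CARD('p) - 1"
  define f where "f = (\<lambda>x :: nat \<Rightarrow> 'p padic_int. pochhammer (1 + ?P * x 0) ?n)"
  have "first_order f" unfolding f_def by (intro first_order_intros) simp
  then obtain c l where f: "\<And>x. ?P ^ 2 dvd f x - (c + ?P * (\<Sum>i<4. l i * x i))"
    unfolding first_order_def by blast
  have f': "?P ^ 2 dvd pochhammer (1 + ?P * s) ?n - (c + ?P * (l 0 * s))" for s
  proof -
    have "(\<Sum>i<4. l i * (if i = 0 then s else 0)) = l 0 * s"
      by (simp add: if_distrib[of "\<lambda>y. _ * y"] sum.delta cong: if_cong)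
    then show ?thesis using f[of "\<lambda>i. if i = 0 then s else 0"] by (simp add: f_def)
  qed
  have n: "even ?n" "CARD('p) = Suc ?n"
    using p CARD_gt_1[where 'p = 'p] by auto
  have "pochhammer (1 + ?P * 0) ?n = fact ?n" by (simp add: pochhammer_fact)
  then have f0: "?P ^ 2 dvd fact ?n - (c + ?P * (l 0 * 0))"
    using f'[of 0] by simp
  \<comment> \<open>With n = p - 1 even, (-n)_n equals n!, so s = 0 and s = -1 give the same
    value.\<close>
  have "1 + ?P * (- 1) = - of_nat ?n" by (subst n(2)) simp
  then have "pochhammer (1 + ?P * (- 1)) ?n = fact ?n"
    using n(1) by (simp only: pochhammer_same) simp
  then have "?P ^ 2 dvd fact ?n - (c + ?P * (l 0 * (- 1)))"
    using f'[of "-1"] by simp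
  then have "?P ^ 2 dvd (fact ?n - (c + ?P * (l 0 * (- 1)))) - (fact ?n - (c + ?P * (l 0 * 0)))"
    using f0 by (rule dvd_diff)
  then have "?P ^ 2 dvd ?P * l 0" by (simp add: algebra_simps)
  then have "?P ^ 2 dvd (c + ?P * (l 0 * s)) - (c + ?P * (l 0 * 0))"
    by (simp add: dvd_mult2 mult.assoc[symmetric])
  then show ?thesis
    by (rule dvd_diff_trans[OF f'[of s] dvd_diff_trans[OF _ dvd_diff_sym[OF f0]]])
qed

lemma padic_CARD_dvd_add_of_nat_iff:
  fixes x :: "'p :: prime_card padic_int"
  assumes "of_nat CARD('p) dvd x"
  shows "of_nat CARD('p) dvd x + of_nat n \<longleftrightarrow> CARD('p) dvd n"
  using assms padic_CARD_dvd_of_int_iff[of "int n", where 'p = 'p] by (simp add: dvd_add_right_iff)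

text \<open>The first of the r + 1 steps leaves a multiple of p and contributes only a sign; the
  remaining r give the rising factorial starting at 1 + p s.\<close>

lemma padic_Gamma_mult_CARD_shift:
  fixes s :: "'p :: prime_card padic_int"
  assumes p: "odd CARD('p)" and "r < CARD('p)"
  shows "padic_Gamma (of_nat CARD('p) * s + of_nat (Suc r))
    = (- 1) ^ Suc r * pochhammer (1 + of_nat CARD('p) * s) r * padic_Gamma (of_nat CARD('p) * s)"
proof -
  let ?P = "of_nat CARD('p) :: 'p padic_int"
  have "\<not> ?P dvd ?P * s + 1 + of_nat i" if "i < r" for i
  proof -
    have "\<not> ?P dvd ?P * s + of_nat (Suc i)"
      using that assms(2) by (subst padic_CARD_dvd_add_of_nat_iff) (auto dest: dvd_imp_le)
    then show ?thesis by (simp add: algebra_simps)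
  qed
  then have "padic_Gamma (?P * s + 1 + of_nat r) = (- 1) ^ r * pochhammer (?P * s + 1) r * padic_Gamma (?P * s + 1)"
    by (intro padic_Gamma_shift[OF p]) auto
  then show ?thesis
    using padic_Gamma_plus_1[OF p, of "?P * s"] by (simp add: algebra_simps)
qed

text \<open>Raising s by 1 multiplies the value by - (p - 1)! modulo p^2, which is 1 + p r by
  Wilson's theorem. Induction settles natural s, and approximation the rest.\<close>

lemma padic_Gamma_mult_CARD:
  assumes p: "odd CARD('p :: prime_card)"
  shows "\<exists>r. \<forall>s :: 'p padic_int. of_nat CARD('p) ^ 2 dvd
    padic_Gamma (of_nat CARD('p) * s) - (1 + of_nat CARD('p) * (r * s))"
proof -
  let ?P = "of_nat CARD('p) :: 'p padic_int" and ?n = "CARD('p) - 1"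
  have n: "even ?n" "CARD('p) = Suc ?n"
    using p CARD_gt_1[where 'p = 'p] by auto
  have "int CARD('p) dvd fact ?n + 1"
    using wilson_theorem[OF prime_card[where 'a = 'p]] by (simp add: cong_iff_dvd_diff)
  then have "?P dvd of_int (fact ?n + 1)" unfolding padic_CARD_dvd_of_int_iff .
  then obtain q where q: "of_int (fact ?n + 1) = ?P * q" by (rule dvdE)
  \<comment> \<open>Minus the Wilson quotient.\<close>
  define r where "r = - q"
  have r: "- fact ?n = 1 + ?P * r" using q by (simp add: r_def algebra_simps)
  have step: "?P ^ 2 dvd padic_Gamma (?P * (s + 1)) - (1 + ?P * r) * padic_Gamma (?P * s)" for s
  proof -
    have "padic_Gamma (?P * (s + 1)) = padic_Gamma (?P * s + of_nat (Suc ?n))"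
      using n(2) by (simp add: distrib_left)
    also have "\<dots> = - pochhammer (1 + ?P * s) ?n * padic_Gamma (?P * s)"
      using n by (subst padic_Gamma_mult_CARD_shift[OF p]) auto
    finally have e: "padic_Gamma (?P * (s + 1)) - (1 + ?P * r) * padic_Gamma (?P * s)
       = - ((pochhammer (1 + ?P * s) ?n - fact ?n) * padic_Gamma (?P * s))"
      unfolding r[symmetric] by (simp add: algebra_simps)
    show ?thesis unfolding e using pochhammer_CARD_minus_1_cong[OF p, of s] by simp
  qed
  have nat: "?P ^ 2 dvd padic_Gamma (?P * of_nat m) - (1 + ?P * (r * of_nat m))" for m
  proof (induction m)
    case 0
    then show ?case using padic_Gamma_of_nat[OF p, of 0] by (simp add: morita_gamma_nat_def)
  next
    case (Suc m)
    have "(1 + ?P * r) * (1 + ?P * (r * of_nat m)) - (1 + ?P * (r * of_nat (Suc m)))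
        = ?P ^ 2 * (r * (r * of_nat m))"
      by (simp add: algebra_simps power2_eq_square)
    then have "?P ^ 2 dvd (1 + ?P * r) * (1 + ?P * (r * of_nat m)) - (1 + ?P * (r * of_nat (Suc m)))"
      by simp
    moreover have "?P ^ 2 dvd (1 + ?P * r) * padic_Gamma (?P * of_nat m) - (1 + ?P * r) * (1 + ?P * (r * of_nat m))"
      using Suc by (intro dvd_diff_mult) auto
    moreover have "?P ^ 2 dvd padic_Gamma (?P * of_nat (Suc m)) - (1 + ?P * r) * padic_Gamma (?P * of_nat m)"
      using step[of "of_nat m"] by (simp add: add.commute)
    ultimately show ?case using dvd_diff_trans by blast
  qed
  have "?P ^ 2 dvd padic_Gamma (?P * s) - (1 + ?P * (r * s))" for s
  proof -
    \<comment> \<open>Agreement modulo p suffices, because s enters both sides multiplied by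
      p.\<close>
    obtain m where "?P ^ 1 dvd s - of_nat m" using padic_nat_cong_ex by blast
    then have m: "?P ^ 2 dvd ?P * (s - of_nat m)"
      unfolding power2_eq_square by (simp add: mult_dvd_mono)
    then have "?P ^ 2 dvd padic_Gamma (?P * s) - padic_Gamma (?P * of_nat m)"
      by (intro padic_Gamma_cong[OF p]) (simp add: right_diff_distrib)
    moreover have "?P ^ 2 dvd (1 + ?P * (r * of_nat m)) - (1 + ?P * (r * s))"
    proof -
      have "(1 + ?P * (r * of_nat m)) - (1 + ?P * (r * s)) = - r * (?P * (s - of_nat m))"
        by (simp add: algebra_simps)
      then show ?thesis using m by (simp del: mult_minus_left)
    qed
    ultimately show ?thesis using nat[of m] dvd_diff_trans by blast
  qed
  then show ?thesis by blast
qed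

text \<open>Modulo p^2 the argument is p y + m with m the residue of the constant term. The shift
  formula peels off m, and \<open>padic_Gamma_mult_CARD\<close> handles the value at p y.\<close>

lemma first_order_Gamma:
  fixes f :: "(nat \<Rightarrow> 'p :: prime_card padic_int) \<Rightarrow> 'p padic_int"
  assumes p: "odd CARD('p)" and "first_order f"
  shows "first_order (\<lambda>x. padic_Gamma (f x))"
proof -
  let ?P = "of_nat CARD('p) :: 'p padic_int"
  obtain c l where f: "\<And>x. ?P ^ 2 dvd f x - (c + ?P * (\<Sum>i<4. l i * x i))"
    using assms(2) unfolding first_order_def by blast
  obtain m where m: "m < CARD('p)" "?P dvd c - of_nat m"
    using padic_residue_unique[of c] by blast
  then obtain c' where c: "c - of_nat m = ?P * c'" by (auto elim: dvdE)
  define y where "y = (\<lambda>x :: nat \<Rightarrow> 'p padic_int. c' + (\<Sum>i<4. l i * x i))"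
  have eq: "c + ?P * (\<Sum>i<4. l i * x i) = ?P * y x + of_nat m" for x
    using c by (simp add: y_def distrib_left diff_eq_eq)
  have *: "?P ^ 2 dvd padic_Gamma (f x) - padic_Gamma (?P * y x + of_nat m)" for x
    using padic_Gamma_cong[OF p f[of x]] unfolding eq .
  obtain r where r: "\<And>s. ?P ^ 2 dvd padic_Gamma (?P * s) - (1 + ?P * (r * s))"
    using padic_Gamma_mult_CARD[OF p] by blast
  have Py: "first_order (\<lambda>x. ?P * y x)"
    by (rule first_orderI[of _ "?P * c'" l]) (simp add: y_def distrib_left)
  then have "first_order (\<lambda>x. 1 + r * (?P * y x))"
    by (intro first_order_add[OF first_order_const first_order_mult[OF first_order_const]])
  then have G: "first_order (\<lambda>x. padic_Gamma (?P * y x))"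
  proof (rule first_order_cong)
    show "?P ^ 2 dvd padic_Gamma (?P * y x) - (1 + r * (?P * y x))" for x
      using r[of "y x"] by (simp only: mult.left_commute[of r])
  qed
  have "first_order (\<lambda>x. padic_Gamma (?P * y x + of_nat m))"
  proof (cases m)
    case 0
    then show ?thesis using G by simp
  next
    case (Suc k)
    then have "(\<lambda>x. padic_Gamma (?P * y x + of_nat m))
      = (\<lambda>x. (- 1) ^ Suc k * pochhammer (1 + ?P * y x) k * padic_Gamma (?P * y x))"
      using padic_Gamma_mult_CARD_shift[OF p, of k] m(1) by (simp only: Suc_lessD)
    then show ?thesis
      using first_order_mult[OF first_order_mult[OF first_order_const
          first_order_pochhammer[OF first_order_add[OF first_order_const Py]]] G]
      by (simp only:)
  qed
  then show ?thesis using * by (rule first_order_cong)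
qed

section \<open>Reduction of the truncated series\<close>

lemma padic_residue_less: "padic_residue (x :: 'p :: prime_card padic_int) < CARD('p)"
  and padic_residue_dvd: "of_nat CARD('p) dvd x - of_nat (padic_residue x)"
  using theI'[OF padic_residue_unique[of x]] unfolding padic_residue_def by blast+

lemma padic_residue_uminus_dvd:
  "of_nat CARD('p) dvd (x :: 'p :: prime_card padic_int) + of_nat (padic_residue (- x))"
proof -
  have "x + of_nat (padic_residue (- x)) = - (- x - of_nat (padic_residue (- x)))" by simp
  then show ?thesis using padic_residue_dvd[of "- x"] by (simp only: dvd_minus_iff)
qed

lemma padic_dvd_add_of_nat_unique:
  fixes x :: "'p :: prime_card padic_int"
  assumes "of_nat CARD('p) dvd x + of_nat d" "of_nat CARD('p) dvd x + of_nat i" "i < CARD('p)" "d < CARD('p)"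
  shows "i = d"
proof -
  have "of_nat CARD('p) dvd (x + of_nat i) - (x + of_nat d)"
    using assms by (intro dvd_diff)
  then have "of_nat CARD('p) dvd (of_int (int i - int d) :: 'p padic_int)" by simp
  then have "int CARD('p) dvd int i - int d" unfolding padic_CARD_dvd_of_int_iff .
  then have "int i mod int CARD('p) = int d mod int CARD('p)" by (simp add: mod_eq_dvd_iff)
  then show ?thesis using assms(3,4) by simp
qed

lemma prime_elem_dvd_prod:
  fixes f :: "'b \<Rightarrow> 'a :: comm_semiring_1"
  assumes "prime_elem q" "q dvd prod f A"
  shows "\<exists>x\<in>A. q dvd f x"
  using assms(2)
proof (induction A rule: infinite_finite_induct)
  case (insert x A)
  then have "q dvd f x \<or> q dvd prod f A"
    using prime_elem_dvd_multD[OF assms(1)] by simp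
  then show ?case using insert.IH by blast
qed (use assms(1) in \<open>simp_all add: prime_elem_def\<close>)

text \<open>Among x, ..., x + p - 1 only x + d is divisible by p.\<close>

lemma padic_dvd_pochhammer_iff:
  fixes x :: "'p :: prime_card padic_int"
  assumes "of_nat CARD('p) dvd x + of_nat d" "d < CARD('p)" "n \<le> CARD('p)"
  shows "of_nat CARD('p) dvd pochhammer x n \<longleftrightarrow> d < n"
proof
  assume "of_nat CARD('p) dvd pochhammer x n"
  then have "\<exists>i\<in>{0..<n}. of_nat CARD('p) dvd x + of_nat i"
    unfolding pochhammer_prod by (rule prime_elem_dvd_prod[OF padic_prime_elem])
  then obtain i where i: "i < n" "of_nat CARD('p) dvd x + of_nat i"
    by auto
  then have "i = d"
    using padic_dvd_add_of_nat_unique[OF assms(1) i(2)] assms(2,3) by simp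
  then show "d < n" using i(1) by simp
next
  assume "d < n"
  then have "(x + of_nat d) dvd pochhammer x n"
    unfolding pochhammer_prod by (intro dvd_prodI) auto
  with assms(1) show "of_nat CARD('p) dvd pochhammer x n"
    by (rule dvd_trans)
qed

lemma padic_not_dvd_fact:
  assumes "n < CARD('p)"
  shows "\<not> of_nat CARD('p) dvd (fact n :: 'p :: prime_card padic_int)"
proof -
  have "1 + of_nat (CARD('p) - 1) = (of_nat CARD('p) :: 'p padic_int)"
    using CARD_gt_1[where 'p = 'p] by (simp add: of_nat_diff)
  then have "of_nat CARD('p) dvd (1 + of_nat (CARD('p) - 1) :: 'p padic_int)" by simp
  then show ?thesis
    using padic_dvd_pochhammer_iff[of "1 :: 'p padic_int" "CARD('p) - 1" n] assms by (simp add: pochhammer_fact)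
qed

section \<open>The inclusion into the p-adic numbers and congruences there\<close>

lemma of_padic_int_hom [simp]:
  "of_padic_int 0 = 0" "of_padic_int 1 = 1"
  "of_padic_int (x + y) = of_padic_int x + of_padic_int y"
  "of_padic_int (x - y) = of_padic_int x - of_padic_int y"
  "of_padic_int (x * y) = of_padic_int x * of_padic_int y"
  by (simp_all add: of_padic_int_def Zero_fract_def One_fract_def)

lemma of_padic_int_of_nat [simp]: "of_padic_int (of_nat n) = of_nat n"
  by (induction n) simp_all

lemma of_padic_int_power [simp]: "of_padic_int (x ^ n) = of_padic_int x ^ n"
  by (induction n) simp_all

lemma of_padic_int_pochhammer [simp]:
  "of_padic_int (pochhammer x n) = pochhammer (of_padic_int x) n"
  by (induction n) (simp_all add: pochhammer_Suc)

lemma of_padic_int_fact [simp]: "of_padic_int (fact n) = fact n"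
  unfolding pochhammer_fact by simp

lemma of_padic_int_sum [simp]: "of_padic_int (sum f A) = (\<Sum>x\<in>A. of_padic_int (f x))"
  by (induction A rule: infinite_finite_induct) simp_all

lemma of_padic_int_eq_iff [simp]: "of_padic_int x = of_padic_int y \<longleftrightarrow> x = y"
  by (simp add: of_padic_int_def eq_fract)

lemma of_padic_int_eq_0_iff [simp]: "of_padic_int x = 0 \<longleftrightarrow> x = 0"
  using of_padic_int_eq_iff[of x 0] by (simp del: of_padic_int_eq_iff)

lemma padic_cong_0_iff: "padic_cong x y m \<longleftrightarrow> padic_cong (x - y) 0 m"
  by (simp add: padic_cong_def)

lemma padic_cong_0_add:
  fixes x y :: "'p :: prime_card padic"
  assumes "padic_cong x 0 m" "padic_cong y 0 m"
  shows "padic_cong (x + y) 0 m"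
proof -
  obtain z w where "x = of_nat CARD('p) ^ m * of_padic_int z" "y = of_nat CARD('p) ^ m * of_padic_int w"
    using assms by (auto simp: padic_cong_def)
  then have "x + y - 0 = of_nat CARD('p) ^ m * of_padic_int (z + w)"
    by (simp add: distrib_left)
  then show ?thesis unfolding padic_cong_def by blast
qed

lemma padic_cong_0_mult:
  fixes x :: "'p :: prime_card padic"
  assumes "padic_cong x 0 m"
  shows "padic_cong (of_padic_int c * x) 0 m"
proof -
  obtain z where "x = of_nat CARD('p) ^ m * of_padic_int z"
    using assms by (auto simp: padic_cong_def)
  then have "of_padic_int c * x - 0 = of_nat CARD('p) ^ m * of_padic_int (c * z)"
    by simp
  then show ?thesis unfolding padic_cong_def by blast
qed

lemma padic_cong_0_sum:
  fixes f :: "'b \<Rightarrow> 'p :: prime_card padic"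
  assumes "\<And>x. x \<in> A \<Longrightarrow> padic_cong (f x) 0 m"
  shows "padic_cong (sum f A) 0 m"
proof -
  have "padic_cong (0 :: 'p padic) 0 m"
    unfolding padic_cong_def by (rule exI[of _ 0]) simp
  then show ?thesis
    using assms by (induction A rule: infinite_finite_induct) (simp_all add: padic_cong_0_add)
qed

lemma padic_cong_divide_unit:
  fixes x u :: "'p :: prime_card padic_int"
  assumes "of_nat CARD('p) ^ m dvd x" "\<not> of_nat CARD('p) dvd u"
  shows "padic_cong (of_padic_int x / of_padic_int u) 0 m"
proof -
  obtain z where z: "x = of_nat CARD('p) ^ m * z" using assms(1) by (rule dvdE)
  obtain v where v: "1 = u * v" using padic_unit[OF assms(2)] by (rule dvdE)
  then have "u \<noteq> 0" by auto
  have "of_padic_int u * of_padic_int v = 1"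
    using v by (metis of_padic_int_hom(2,5))
  then have "of_padic_int x / of_padic_int u - 0 = of_nat CARD('p) ^ m * of_padic_int (z * v)"
    using \<open>u \<noteq> 0\<close> by (simp add: z field_simps)
  then show ?thesis unfolding padic_cong_def by blast
qed

text \<open>At most one factor p cancels, and what is left of the denominator is a unit. This is the
  shape of the terms beyond the truncation point.\<close>

lemma padic_cong_divide_tail:
  fixes x u :: "'p :: prime_card padic_int"
  assumes "of_nat CARD('p) ^ 3 dvd x" "\<not> of_nat CARD('p) ^ 2 dvd u"
  shows "padic_cong (of_padic_int x / of_padic_int u) 0 2"
proof (cases "of_nat CARD('p) dvd u")
  case True
  let ?P = "of_nat CARD('p) :: 'p padic_int"
  have P: "?P \<noteq> 0" using CARD_gt_1[where 'p = 'p] by simp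
  obtain w where w: "u = ?P * w" using True by (rule dvdE)
  obtain z where z: "x = ?P ^ 3 * z" using assms(1) by (rule dvdE)
  have "\<not> ?P dvd w"
    using assms(2) P by (simp add: w power2_eq_square)
  moreover have "of_padic_int x / of_padic_int u = of_padic_int (?P ^ 2 * z) / of_padic_int w"
    using P by (simp add: w z power2_eq_square power3_eq_cube)
  ultimately show ?thesis using padic_cong_divide_unit[of 2 "?P ^ 2 * z" w] by simp
next
  case False
  have "of_nat CARD('p) ^ 2 dvd x"
    using assms(1) by (rule power_le_dvd) simp
  then show ?thesis using padic_cong_divide_unit False by blast
qed

text \<open>The terms up to d add up exactly to the quotient. For larger k each of the three upper
  symbols has a factor divisible by p.\<close>

lemma trunc_hypergeo_padic_cong:
  fixes \<alpha> \<beta> \<gamma> \<delta> :: "'p :: prime_card padic_int"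
  assumes a: "of_nat CARD('p) dvd \<alpha> + of_nat a" "a \<le> d"
    and b: "of_nat CARD('p) dvd \<beta> + of_nat b" "b \<le> d"
    and c: "of_nat CARD('p) dvd \<gamma> + of_nat c" "c \<le> d"
    and d: "of_nat CARD('p) dvd \<delta> + of_nat d" "d < CARD('p)"
    and nd: "\<not> of_nat CARD('p) ^ 2 dvd pochhammer \<delta> (CARD('p) - 1)"
  shows "padic_cong
    (trunc_hypergeo [of_padic_int \<alpha>, of_padic_int \<beta>, of_padic_int \<gamma>] [1, of_padic_int \<delta>] 1 (CARD('p) - 1))
    (of_padic_int (hyp3F2 d \<alpha> \<beta> \<gamma> \<delta>) / of_padic_int (pochhammer \<delta> d * (fact d)^2)) 2"
proof -
  let ?P = "of_nat CARD('p) :: 'p padic_int"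
  define N where "N = (\<lambda>k. pochhammer \<alpha> k * pochhammer \<beta> k * pochhammer \<gamma> k)"
  define g where "g = (\<lambda>k. of_padic_int (N k) / of_padic_int (pochhammer \<delta> k * (fact k)^2))"
  have pd: "\<not> ?P dvd pochhammer \<delta> d"
    using padic_dvd_pochhammer_iff[OF d, of d] d by simp
  then have pd0: "pochhammer \<delta> d \<noteq> 0" by auto
  have "trunc_hypergeo [of_padic_int \<alpha>, of_padic_int \<beta>, of_padic_int \<gamma>] [1, of_padic_int \<delta>] 1 (CARD('p) - 1)
    = (\<Sum>k\<le>CARD('p) - 1. g k)"
    unfolding trunc_hypergeo_def g_def N_def
    by (intro sum.cong) (simp_all add: power2_eq_square mult_ac flip: pochhammer_fact)
  also have "{..CARD('p) - 1} = {..d} \<union> {d<..CARD('p) - 1}"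
    using d by auto
  also have "sum g \<dots> = sum g {..d} + sum g {d<..CARD('p) - 1}"
    by (rule sum.union_disjoint) auto
  also have "sum g {..d} = of_padic_int (hyp3F2 d \<alpha> \<beta> \<gamma> \<delta>) / of_padic_int (pochhammer \<delta> d * (fact d)^2)"
    unfolding hyp3F2_def of_padic_int_sum sum_divide_distrib
  proof (intro sum.cong refl)
    fix k assume "k \<in> {..d}"
    then have k: "k \<le> d" by simp
    have N: "pochhammer \<alpha> k * pochhammer \<beta> k * pochhammer \<gamma> k = N k"
      by (simp add: N_def)
    define q where "q = pochhammer (1 + of_nat k :: 'p padic_int) (d - k)"
    define r where "r = pochhammer (\<delta> + of_nat k) (d - k)"
    have f: "fact d = fact k * q"
      unfolding q_def by (rule fact_split[OF k])
    have e: "pochhammer \<delta> d = pochhammer \<delta> k * r"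
      unfolding r_def by (rule pochhammer_product[OF k])
    have "fact d \<noteq> (0 :: 'p padic_int)" by simp
    then have nz: "q \<noteq> 0" "r \<noteq> 0" "pochhammer \<delta> k \<noteq> 0" "of_padic_int q \<noteq> 0"
      using f e pd0 by auto
    show "g k = of_padic_int (pochhammer \<alpha> k * pochhammer \<beta> k * pochhammer \<gamma> k
      * pochhammer (\<delta> + of_nat k) (d - k) * (pochhammer (1 + of_nat k) (d - k))^2)
      / of_padic_int (pochhammer \<delta> d * (fact d)^2)"
      unfolding g_def N q_def[symmetric] r_def[symmetric] f e of_padic_int_hom of_padic_int_power
      using nz by (simp add: power_mult_distrib del: of_padic_int_pochhammer of_padic_int_fact)
  qed
  finally have eq: "trunc_hypergeo [of_padic_int \<alpha>, of_padic_int \<beta>, of_padic_int \<gamma>] [1, of_padic_int \<delta>] 1 (CARD('p) - 1)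
    - of_padic_int (hyp3F2 d \<alpha> \<beta> \<gamma> \<delta>) / of_padic_int (pochhammer \<delta> d * (fact d)^2) = sum g {d<..CARD('p) - 1}"
    by simp
  have "padic_cong (sum g {d<..CARD('p) - 1}) 0 2"
  proof (rule padic_cong_0_sum)
    fix k assume "k \<in> {d<..CARD('p) - 1}"
    then have k: "d < k" "k \<le> CARD('p) - 1" "k < CARD('p)" using d by auto
    have "?P dvd pochhammer \<alpha> k" "?P dvd pochhammer \<beta> k" "?P dvd pochhammer \<gamma> k"
      using padic_dvd_pochhammer_iff[OF a(1), of k] padic_dvd_pochhammer_iff[OF b(1), of k]
        padic_dvd_pochhammer_iff[OF c(1), of k] a b c d k by auto
    then have "?P ^ 3 dvd N k"
      unfolding N_def power3_eq_cube by (intro mult_dvd_mono)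
    moreover have "\<not> ?P ^ 2 dvd pochhammer \<delta> k * (fact k)^2"
    proof
      assume *: "?P ^ 2 dvd pochhammer \<delta> k * (fact k)^2"
      \<comment> \<open>Removing the unit k!^2 leaves (\<delta>)_k, a divisor of
        (\<delta>)_{p-1}.\<close>
      obtain v where v: "1 = (fact k :: 'p padic_int) * v"
        using padic_unit[OF padic_not_dvd_fact[OF k(3)]] by (rule dvdE)
      have "pochhammer \<delta> k * (fact k)^2 dvd pochhammer \<delta> k * (fact k)^2 * v^2" by simp
      also have "pochhammer \<delta> k * (fact k)^2 * v^2 = pochhammer \<delta> k * (fact k * v)^2"
        by (simp add: power_mult_distrib mult_ac)
      also have "\<dots> = pochhammer \<delta> k" unfolding v[symmetric] by simp
      also have "\<dots> dvd pochhammer \<delta> (CARD('p) - 1)"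
        using pochhammer_product[OF k(2), of \<delta>] by simp
      finally show False using * nd dvd_trans by blast
    qed
    ultimately show "padic_cong (g k) 0 2"
      unfolding g_def by (rule padic_cong_divide_tail)
  qed
  then show ?thesis unfolding padic_cong_def eq by simp
qed

section \<open>The transformation modulo \<open>p\<^sup>2\<close>\<close>

lemma padic_Gamma_shift_below:
  fixes x :: "'p :: prime_card padic_int"
  assumes p: "odd CARD('p)" and "of_nat CARD('p) dvd x + of_nat d" "d < CARD('p)" "n \<le> d"
  shows "padic_Gamma (x + of_nat n) = (- 1) ^ n * pochhammer x n * padic_Gamma x"
proof (rule padic_Gamma_shift[OF p])
  fix i assume "i < n"
  then show "\<not> of_nat CARD('p) dvd x + of_nat i"
    using padic_dvd_add_of_nat_unique[OF assms(2), of i] assms(3,4) by auto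
qed

text \<open>Here x + d = p is the only multiple of p among x, ..., x + n - 1; the gamma function skips it.\<close>

lemma padic_Gamma_shift_across:
  fixes x :: "'p :: prime_card padic_int"
  assumes p: "odd CARD('p)" and x: "x + of_nat d = of_nat CARD('p)" "d < CARD('p)"
    and n: "d < n" "n \<le> CARD('p) + d"
  shows "padic_Gamma (x + of_nat n) * of_nat CARD('p) = (- 1) ^ n * pochhammer x n * padic_Gamma x"
proof -
  let ?P = "of_nat CARD('p) :: 'p padic_int"
  define m where "m = n - Suc d"
  have m: "n = d + Suc m" "m < CARD('p)" using n by (auto simp: m_def)
  have 1: "padic_Gamma ?P = (- 1) ^ d * pochhammer x d * padic_Gamma x"
    using padic_Gamma_shift_below[OF p, of x d d] x by simp
  have "padic_Gamma (?P * 1 + of_nat (Suc m)) = (- 1) ^ Suc m * pochhammer (1 + ?P * 1) m * padic_Gamma (?P * 1)"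
    by (rule padic_Gamma_mult_CARD_shift[OF p m(2)])
  moreover have "x + of_nat n = ?P * 1 + of_nat (Suc m)"
    using x(1) by (simp add: m(1) algebra_simps)
  ultimately have 2: "padic_Gamma (x + of_nat n) = (- 1) ^ Suc m * pochhammer (1 + ?P) m * padic_Gamma ?P"
    by simp
  have "pochhammer x n = pochhammer x d * pochhammer ?P (Suc m)"
    unfolding m(1) pochhammer_product' x(1) ..
  also have "pochhammer ?P (Suc m) = ?P * pochhammer (1 + ?P) m"
    by (simp add: pochhammer_rec add.commute)
  finally show ?thesis
    unfolding 2 1 by (simp add: m(1) power_add mult_ac)
qed

text \<open>The exact transformation at truncation n, carried over to the truncations d and e. The
  factor w is 1 if the gamma shifts meet no multiple of p, and p if each meets one; being common to
  both sides, it cancels.\<close>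

lemma hyp3F2_Gamma_identity:
  fixes \<beta> \<gamma> \<delta> \<epsilon> w :: "'p :: prime_card padic_int" and n d e :: nat
  defines "\<alpha> \<equiv> - of_nat n"
  assumes \<epsilon>: "\<epsilon> = 1 + \<delta> - \<beta> - \<gamma>"
    and d: "\<And>k. k > min d n \<Longrightarrow> pochhammer \<alpha> k * pochhammer \<beta> k * pochhammer \<gamma> k = 0"
    and e: "\<And>k. k > min e n \<Longrightarrow> pochhammer \<alpha> k * pochhammer (1 - \<beta>) k * pochhammer (1 - \<gamma>) k = 0"
    and w: "w \<noteq> 0" "padic_Gamma (\<delta> + of_nat n) * w = (- 1) ^ n * pochhammer \<delta> n * padic_Gamma \<delta>"
      "padic_Gamma (\<epsilon> + of_nat n) * w = (- 1) ^ n * pochhammer \<epsilon> n * padic_Gamma \<epsilon>"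
  shows "hyp3F2 d \<alpha> \<beta> \<gamma> \<delta> * padic_Gamma (\<delta> - \<alpha>) * padic_Gamma \<epsilon> * (pochhammer \<epsilon> e * (fact e)^2)
    = padic_Gamma \<delta> * padic_Gamma (\<epsilon> - \<alpha>) * hyp3F2 e \<alpha> (1 - \<beta>) (1 - \<gamma>) \<epsilon> * (pochhammer \<delta> d * (fact d)^2)"
proof -
  define S where "S = hyp3F2 n \<alpha> \<beta> \<gamma> \<delta>"
  define A where "A = hyp3F2 d \<alpha> \<beta> \<gamma> \<delta>"
  define B where "B = hyp3F2 e \<alpha> (1 - \<beta>) (1 - \<gamma>) \<epsilon>"
  define X where "X = pochhammer \<delta> d * (fact d)^2"
  define Y where "Y = pochhammer \<epsilon> e * (fact e)^2"
  define f where "f = (fact n :: 'p padic_int)^2"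
  have "f \<noteq> 0" by (simp add: f_def)
  have SX: "S * X = A * (pochhammer \<delta> n * f)"
    unfolding S_def A_def X_def f_def by (rule hyp3F2_terminating_cross[OF d])
  have "S = hyp3F2 n \<alpha> (1 - \<beta>) (1 - \<gamma>) \<epsilon>"
    unfolding S_def \<alpha>_def \<epsilon> by (rule hyp3F2_transform)
  then have SY: "S * Y = B * (pochhammer \<epsilon> n * f)"
    using hyp3F2_terminating_cross[OF e] by (simp add: B_def Y_def f_def)
  have "f * (A * pochhammer \<delta> n * Y) = S * X * Y" by (simp add: SX mult_ac)
  also have "\<dots> = S * Y * X" by (simp only: mult_ac)
  also have "\<dots> = f * (B * pochhammer \<epsilon> n * X)" by (simp add: SY mult_ac)
  finally have AB: "A * pochhammer \<delta> n * Y = B * pochhammer \<epsilon> n * X" using \<open>f \<noteq> 0\<close> by simp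
  have "w * (A * padic_Gamma (\<delta> + of_nat n) * padic_Gamma \<epsilon> * Y)
      = A * padic_Gamma \<epsilon> * Y * (padic_Gamma (\<delta> + of_nat n) * w)" by (simp only: mult_ac)
  also have "\<dots> = (- 1) ^ n * padic_Gamma \<delta> * padic_Gamma \<epsilon> * (A * pochhammer \<delta> n * Y)"
    unfolding w(2) by (simp only: mult_ac)
  also have "\<dots> = B * padic_Gamma \<delta> * X * (padic_Gamma (\<epsilon> + of_nat n) * w)"
    unfolding AB w(3) by (simp only: mult_ac)
  also have "\<dots> = w * (padic_Gamma \<delta> * padic_Gamma (\<epsilon> + of_nat n) * B * X)" by (simp only: mult_ac)
  finally have "A * padic_Gamma (\<delta> + of_nat n) * padic_Gamma \<epsilon> * Y = padic_Gamma \<delta> * padic_Gamma (\<epsilon> + of_nat n) * B * X"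
    using w(1) by simp
  then show ?thesis by (simp add: A_def B_def X_def Y_def \<alpha>_def)
qed

text \<open>Vanishing on the hyperplane x 0 = 0 leaves only the term p (l 0) (x 0) modulo p^2, and
  the point y shows that p (l 0) is 0 modulo p^2.\<close>

lemma first_order_vanish:
  fixes D :: "(nat \<Rightarrow> 'p :: prime_card padic_int) \<Rightarrow> 'p padic_int"
  assumes D: "first_order D" and 0: "\<And>x. x 0 = 0 \<Longrightarrow> D x = 0" and y: "y 0 = - 1" "D y = 0"
  shows "of_nat CARD('p) ^ 2 dvd D x"
proof -
  let ?P = "of_nat CARD('p) :: 'p padic_int"
  obtain c l where l: "\<And>x. ?P ^ 2 dvd D x - (c + ?P * (\<Sum>i<4. l i * x i))"
    using D unfolding first_order_def by blast
  have sum: "(\<Sum>i<4. l i * x i) = l 0 * x 0 + (\<Sum>i<4. l i * (x(0 := 0)) i)" for x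
  proof -
    have "(\<Sum>i<4. l i * x i) = (\<Sum>i<4. l i * (x(0 := 0)) i + (if i = 0 then l 0 * x 0 else 0))"
      by (intro sum.cong) auto
    then show ?thesis by (simp add: sum.distrib)
  qed
  \<comment> \<open>Comparison with the point whose coordinate 0 is reset to 0, where D
    vanishes.\<close>
  have *: "?P ^ 2 dvd D x - ?P * (l 0 * x 0)" for x
  proof -
    have "?P ^ 2 dvd (D x - (c + ?P * (\<Sum>i<4. l i * x i))) - (D (x(0 := 0)) - (c + ?P * (\<Sum>i<4. l i * (x(0 := 0)) i)))"
      by (intro dvd_diff l)
    moreover have "D (x(0 := 0)) = 0" by (rule 0) simp
    ultimately show ?thesis unfolding sum[of x] by (simp add: algebra_simps)
  qed
  have "?P ^ 2 dvd ?P * l 0" using *[of y] y by simp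
  then have "?P ^ 2 dvd ?P * (l 0 * x 0)" by (simp add: dvd_mult2 flip: mult.assoc)
  then show ?thesis using *[of x] dvd_diff_trans[of "?P ^ 2" "D x" "?P * (l 0 * x 0)" 0] by simp
qed

text \<open>The main congruence with denominators cleared. Here e is the residue of - \<epsilon>,
  and a \<le> e is the bound on the sum of a, b and c. The difference is built from ring operations
  and gamma values, hence is of first order.\<close>

lemma hyp3F2_Gamma_cong:
  fixes \<alpha> \<beta> \<gamma> \<delta> :: "'p :: prime_card padic_int"
  assumes p: "odd CARD('p)"
    and \<alpha>: "of_nat CARD('p) dvd \<alpha> + of_nat a" and \<beta>: "of_nat CARD('p) dvd \<beta> + of_nat b"
    and \<gamma>: "of_nat CARD('p) dvd \<gamma> + of_nat c" and \<delta>: "of_nat CARD('p) dvd \<delta> + of_nat d"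
    and abcd: "a \<le> d" "b \<le> d" "c \<le> d" "d < CARD('p)" "d \<le> b + c" and e: "e + b + c + 1 = CARD('p) + d" and ae: "a \<le> e"
  defines "\<epsilon> \<equiv> 1 + \<delta> - \<beta> - \<gamma>"
  shows "of_nat CARD('p) ^ 2 dvd
    hyp3F2 d \<alpha> \<beta> \<gamma> \<delta> * padic_Gamma (\<delta> - \<alpha>) * padic_Gamma \<epsilon> * (pochhammer \<epsilon> e * (fact e)^2)
    - padic_Gamma \<delta> * padic_Gamma (\<epsilon> - \<alpha>) * hyp3F2 e \<alpha> (1 - \<beta>) (1 - \<gamma>) \<epsilon> * (pochhammer \<delta> d * (fact d)^2)"
proof -
  let ?P = "of_nat CARD('p) :: 'p padic_int"
  \<comment> \<open>The first bound uses d \<le> b + c, the second b \<le> d.\<close>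
  have ep: "e < CARD('p)" "CARD('p) - 1 - c \<le> e" using e abcd by linarith+
  have eP: "of_nat e + of_nat b + of_nat c + 1 = ?P + of_nat d"
    using arg_cong[OF e, of "of_nat :: nat \<Rightarrow> 'p padic_int"] by (simp add: add_ac)
  define F where "F = (\<lambda>\<alpha> \<beta> \<gamma> \<delta> :: 'p padic_int. let \<epsilon> = 1 + \<delta> - \<beta> - \<gamma> in
    hyp3F2 d \<alpha> \<beta> \<gamma> \<delta> * padic_Gamma (\<delta> - \<alpha>) * padic_Gamma \<epsilon> * (pochhammer \<epsilon> e * (fact e)^2)
    - padic_Gamma \<delta> * padic_Gamma (\<epsilon> - \<alpha>) * hyp3F2 e \<alpha> (1 - \<beta>) (1 - \<gamma>) \<epsilon> * (pochhammer \<delta> d * (fact d)^2))"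
  define D where "D = (\<lambda>x :: nat \<Rightarrow> 'p padic_int. F (?P * x 0 - of_nat a) (?P * x 1 - of_nat b)
     (?P * x 2 - of_nat c) (?P * x 3 - of_nat d))"
  have fo: "first_order D"
    unfolding D_def F_def Let_def hyp3F2_def
    by (intro first_order_intros first_order_Gamma[OF p]) simp_all
  \<comment> \<open>At \<open>x 0 = 0\<close> the first parameter is \<open>- a\<close>, so both series terminate.\<close>
  have D0: "D x = 0" if "x 0 = 0" for x
  proof -
    define \<beta>' where "\<beta>' = ?P * x 1 - of_nat b"
    define \<gamma>' where "\<gamma>' = ?P * x 2 - of_nat c"
    define \<delta>' where "\<delta>' = ?P * x 3 - of_nat d"
    define \<epsilon>' where "\<epsilon>' = 1 + \<delta>' - \<beta>' - \<gamma>'"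
    have "\<epsilon>' + of_nat e = ?P * (1 + x 3 - x 1 - x 2)"
      using eP by (simp add: \<epsilon>'_def \<beta>'_def \<gamma>'_def \<delta>'_def algebra_simps)
    then have \<epsilon>': "?P dvd \<epsilon>' + of_nat e" by simp
    have \<delta>': "?P dvd \<delta>' + of_nat d" by (simp add: \<delta>'_def)
    have "hyp3F2 d (- of_nat a) \<beta>' \<gamma>' \<delta>' * padic_Gamma (\<delta>' - - of_nat a) * padic_Gamma \<epsilon>' * (pochhammer \<epsilon>' e * (fact e)^2)
      = padic_Gamma \<delta>' * padic_Gamma (\<epsilon>' - - of_nat a) * hyp3F2 e (- of_nat a) (1 - \<beta>') (1 - \<gamma>') \<epsilon>' * (pochhammer \<delta>' d * (fact d)^2)"
    proof (rule hyp3F2_Gamma_identity[where w = 1])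
      show "padic_Gamma (\<delta>' + of_nat a) * 1 = (- 1) ^ a * pochhammer \<delta>' a * padic_Gamma \<delta>'"
        using padic_Gamma_shift_below[OF p \<delta>'] abcd by simp
      show "padic_Gamma (\<epsilon>' + of_nat a) * 1 = (- 1) ^ a * pochhammer \<epsilon>' a * padic_Gamma \<epsilon>'"
        using padic_Gamma_shift_below[OF p \<epsilon>'] ep ae by simp
    qed (use abcd ae in \<open>auto simp: \<epsilon>'_def pochhammer_of_nat_eq_0_iff\<close>)
    then show ?thesis
      using that unfolding D_def F_def Let_def \<beta>'_def[symmetric] \<gamma>'_def[symmetric] \<delta>'_def[symmetric] \<epsilon>'_def[symmetric]
      by simp
  qed
  \<comment> \<open>At y the parameters are \<open>- (p + a)\<close>, \<open>- b\<close>, \<open>p - c\<close>, \<open>p - d\<close>: the first one makes the terminating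
    transformation applicable, while the second and third cut the two series off at b \<open>\<le>\<close> d and
    \<open>p - 1 - c \<le> e\<close>.\<close>
  define y where "y = (\<lambda>i :: nat. if i = 0 then - 1 else if i = 1 then 0 else 1 :: 'p padic_int)"
  have Dy: "D y = 0"
  proof -
    define n where "n = CARD('p) + a"
    define \<beta>' where "\<beta>' = - (of_nat b :: 'p padic_int)"
    define \<gamma>' where "\<gamma>' = ?P - of_nat c"
    define \<delta>' where "\<delta>' = ?P - of_nat d"
    define \<epsilon>' where "\<epsilon>' = 1 + \<delta>' - \<beta>' - \<gamma>'"
    have \<epsilon>': "\<epsilon>' + of_nat e = ?P"
      using eP by (simp add: \<epsilon>'_def \<beta>'_def \<gamma>'_def \<delta>'_def algebra_simps)
    have \<delta>': "\<delta>' + of_nat d = ?P" by (simp add: \<delta>'_def)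
    have g: "1 - \<gamma>' = - of_nat (CARD('p) - 1 - c)"
      using abcd by (simp add: \<gamma>'_def of_nat_diff)
    have "hyp3F2 d (- of_nat n) \<beta>' \<gamma>' \<delta>' * padic_Gamma (\<delta>' - - of_nat n) * padic_Gamma \<epsilon>' * (pochhammer \<epsilon>' e * (fact e)^2)
      = padic_Gamma \<delta>' * padic_Gamma (\<epsilon>' - - of_nat n) * hyp3F2 e (- of_nat n) (1 - \<beta>') (1 - \<gamma>') \<epsilon>' * (pochhammer \<delta>' d * (fact d)^2)"
    \<comment> \<open>Starting from \<delta>' and \<epsilon>', p is reached after d and e steps. A
      shift by n = p + a passes p but not 2 p, as a \<le> d and a \<le> e; so w = p for
      both.\<close>
    proof (rule hyp3F2_Gamma_identity[where w = "?P"])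
      show "padic_Gamma (\<delta>' + of_nat n) * ?P = (- 1) ^ n * pochhammer \<delta>' n * padic_Gamma \<delta>'"
        using abcd by (intro padic_Gamma_shift_across[OF p \<delta>']) (auto simp: n_def)
      show "padic_Gamma (\<epsilon>' + of_nat n) * ?P = (- 1) ^ n * pochhammer \<epsilon>' n * padic_Gamma \<epsilon>'"
        using ep ae by (intro padic_Gamma_shift_across[OF p \<epsilon>']) (auto simp: n_def)
      show "pochhammer (- of_nat n) k * pochhammer \<beta>' k * pochhammer \<gamma>' k = 0" if "min d n < k" for k
        using that abcd by (auto simp: \<beta>'_def n_def pochhammer_of_nat_eq_0_iff)
      show "pochhammer (- of_nat n) k * pochhammer (1 - \<beta>') k * pochhammer (1 - \<gamma>') k = 0" if "min e n < k" for k
        using that ep unfolding g by (auto simp: n_def pochhammer_of_nat_eq_0_iff)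
    qed (use CARD_gt_1[where 'p = 'p] in \<open>auto simp: \<epsilon>'_def\<close>)
    moreover have "?P * y 0 - of_nat a = - of_nat n" "?P * y 1 - of_nat b = \<beta>'"
        "?P * y 2 - of_nat c = \<gamma>'" "?P * y 3 - of_nat d = \<delta>'"
      by (simp_all add: y_def n_def \<beta>'_def \<gamma>'_def \<delta>'_def)
    ultimately show ?thesis
      unfolding D_def F_def Let_def by (simp add: \<epsilon>'_def)
  qed
  have "y 0 = - 1" by (simp add: y_def)
  then have D: "?P ^ 2 dvd D x" for x
    using first_order_vanish[OF fo D0 _ Dy] by blast
  obtain s where s: "\<alpha> + of_nat a = ?P * s" using \<alpha> by (rule dvdE)
  obtain t where t: "\<beta> + of_nat b = ?P * t" using \<beta> by (rule dvdE)
  obtain u where u: "\<gamma> + of_nat c = ?P * u" using \<gamma> by (rule dvdE)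
  obtain v where v: "\<delta> + of_nat d = ?P * v" using \<delta> by (rule dvdE)
  from s t u v have "\<alpha> = ?P * s - of_nat a" "\<beta> = ?P * t - of_nat b" "\<gamma> = ?P * u - of_nat c" "\<delta> = ?P * v - of_nat d"
    by (simp_all only: eq_diff_eq)
  then have "D (\<lambda>i. if i = 0 then s else if i = 1 then t else if i = 2 then u else v) = F \<alpha> \<beta> \<gamma> \<delta>"
    by (simp add: D_def)
  with D[of "\<lambda>i. if i = 0 then s else if i = 1 then t else if i = 2 then u else v"]
  have "?P ^ 2 dvd F \<alpha> \<beta> \<gamma> \<delta>" by (simp only:)
  then show ?thesis unfolding F_def Let_def \<epsilon>_def .
qed

lemma padic_cong_of_padic_int:
  fixes x :: "'p :: prime_card padic_int"
  assumes "of_nat CARD('p) ^ m dvd x"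
  shows "padic_cong (of_padic_int x) 0 m"
proof -
  obtain z where "x = of_nat CARD('p) ^ m * z" using assms by (rule dvdE)
  then have "of_padic_int x - 0 = of_nat CARD('p) ^ m * of_padic_int z" by simp
  then show ?thesis unfolding padic_cong_def by blast
qed

lemma padic_not_dvd_mult:
  fixes x y :: "'p :: prime_card padic_int"
  assumes "\<not> of_nat CARD('p) dvd x" "\<not> of_nat CARD('p) dvd y"
  shows "\<not> of_nat CARD('p) dvd x * y"
  using prime_elem_dvd_multD[OF padic_prime_elem] assms by blast

theorem theorem2p12:
  fixes \<alpha> \<beta> \<gamma> \<delta> :: "'p :: prime_card padic_int"
    and p :: nat
  assumes "p = CARD('p)" and "odd p"
    and "max (padic_residue (- \<alpha>)) (max (padic_residue (- \<beta>)) (padic_residue (- \<gamma>)))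
           \<le> padic_residue (- \<delta>)"
    and "padic_residue (- \<alpha>) + padic_residue (- \<beta>) + padic_residue (- \<gamma>)
           < p + padic_residue (- \<delta>)"
    and "padic_residue (- \<beta>) + padic_residue (- \<gamma>) \<ge> padic_residue (- \<delta>)"
    and "\<not> padic_cong (of_padic_int (pochhammer \<delta> (p - 1))) 0 2"
    and "\<not> padic_cong (of_padic_int (pochhammer (1 + \<delta> - \<beta> - \<gamma>) (p - 1))) 0 2"
  shows "padic_cong
    (trunc_hypergeo
       [of_padic_int \<alpha>, of_padic_int \<beta>, of_padic_int \<gamma>]
       [1, of_padic_int \<delta>] 1 (p - 1))
    (of_padic_int (padic_Gamma \<delta>) * of_padic_int (padic_Gamma (1 + \<delta> - \<alpha> - \<beta> - \<gamma>))
       / (of_padic_int (padic_Gamma (\<delta> - \<alpha>)) * of_padic_int (padic_Gamma (1 + \<delta> - \<beta> - \<gamma>)))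
     * trunc_hypergeo
         [of_padic_int \<alpha>, of_padic_int (1 - \<beta>), of_padic_int (1 - \<gamma>)]
         [1, of_padic_int (1 + \<delta> - \<beta> - \<gamma>)] 1 (p - 1))
    2"
proof -
  let ?P = "of_nat CARD('p) :: 'p padic_int" and ?o = "of_padic_int :: 'p padic_int \<Rightarrow> 'p padic"
  define a where "a = padic_residue (- \<alpha>)"
  define b where "b = padic_residue (- \<beta>)"
  define c where "c = padic_residue (- \<gamma>)"
  define d where "d = padic_residue (- \<delta>)"
  \<comment> \<open>The residue of - \<epsilon>. Condition (ii) prevents truncation of the
    subtraction and yields a \<le> e; condition (iii) yields e < p.\<close>
  define e where "e = p + d - (1 + b + c)"
  define \<epsilon> where "\<epsilon> = 1 + \<delta> - \<beta> - \<gamma>"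
  have p: "odd CARD('p)" using assms(1,2) by simp
  have dvd: "?P dvd \<alpha> + of_nat a" "?P dvd \<beta> + of_nat b" "?P dvd \<gamma> + of_nat c" "?P dvd \<delta> + of_nat d"
    unfolding a_def b_def c_def d_def by (rule padic_residue_uminus_dvd)+
  have abcd: "a \<le> d" "b \<le> d" "c \<le> d" "d < CARD('p)" "d \<le> b + c" "a + b + c < CARD('p) + d"
    using assms padic_residue_less[of "- \<delta>"] by (simp_all add: a_def b_def c_def d_def)
  have e: "e + b + c + 1 = CARD('p) + d" "a \<le> e" "e < CARD('p)" "CARD('p) - 1 - b \<le> e" "CARD('p) - 1 - c \<le> e"
    using abcd assms(1) by (auto simp: e_def)
  have "\<epsilon> + of_nat e = (\<delta> + of_nat d) - (\<beta> + of_nat b) - (\<gamma> + of_nat c) + ?P"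
    using arg_cong[OF e(1), of "of_nat :: nat \<Rightarrow> 'p padic_int"] by (simp add: \<epsilon>_def algebra_simps)
  then have \<epsilon>: "?P dvd \<epsilon> + of_nat e" using dvd by simp
  \<comment> \<open>If - x has residue i, then - (1 - x) has residue p - 1 - i; for \<beta> and
    \<gamma> this is at most e, so the right series also reduces.\<close>
  have reflect: "?P dvd 1 - x + of_nat (CARD('p) - 1 - i)" if "?P dvd x + of_nat i" "i < CARD('p)" for x i
  proof -
    have eq: "1 - x + of_nat (CARD('p) - 1 - i) = ?P - (x + of_nat i)"
      using that(2) by (simp add: of_nat_diff)
    show ?thesis unfolding eq using that(1) by (intro dvd_diff) auto
  qed
  define A where "A = hyp3F2 d \<alpha> \<beta> \<gamma> \<delta>"
  define B where "B = hyp3F2 e \<alpha> (1 - \<beta>) (1 - \<gamma>) \<epsilon>"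
  define X where "X = pochhammer \<delta> d * (fact d)^2"
  define Y where "Y = pochhammer \<epsilon> e * (fact e)^2"
  define T where "T = trunc_hypergeo [?o \<alpha>, ?o \<beta>, ?o \<gamma>] [1, ?o \<delta>] 1 (CARD('p) - 1)"
  define U where "U = trunc_hypergeo [?o \<alpha>, ?o (1 - \<beta>), ?o (1 - \<gamma>)] [1, ?o \<epsilon>] 1 (CARD('p) - 1)"
  define g where "g = padic_Gamma \<delta> * padic_Gamma (\<epsilon> - \<alpha>)"
  define h where "h = padic_Gamma (\<delta> - \<alpha>) * padic_Gamma \<epsilon>"
  have T: "padic_cong (T - ?o A / ?o X) 0 2"
    unfolding T_def A_def X_def padic_cong_0_iff[symmetric]
    using assms(6) padic_cong_of_padic_int[of 2 "pochhammer \<delta> (CARD('p) - 1)"] dvd abcd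
    by (intro trunc_hypergeo_padic_cong[where a = a and b = b and c = c]) (auto simp: assms(1))
  have U: "padic_cong (U - ?o B / ?o Y) 0 2"
    unfolding U_def B_def Y_def padic_cong_0_iff[symmetric]
    using assms(7) padic_cong_of_padic_int[of 2 "pochhammer \<epsilon> (CARD('p) - 1)"] dvd abcd e \<epsilon> reflect[OF dvd(2)] reflect[OF dvd(3)]
    by (intro trunc_hypergeo_padic_cong[where a = a and b = "CARD('p) - 1 - b" and c = "CARD('p) - 1 - c"])
      (auto simp: assms(1) \<epsilon>_def)
  have nX: "\<not> ?P dvd X"
    unfolding X_def power2_eq_square using padic_dvd_pochhammer_iff[OF dvd(4), of d] abcd
    by (intro padic_not_dvd_mult padic_not_dvd_fact) auto
  have nY: "\<not> ?P dvd Y"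
    unfolding Y_def power2_eq_square using padic_dvd_pochhammer_iff[OF \<epsilon>, of e] e
    by (intro padic_not_dvd_mult padic_not_dvd_fact) auto
  have nh: "\<not> ?P dvd h"
    unfolding h_def by (intro padic_not_dvd_mult padic_Gamma_not_dvd p)
  have nz: "X \<noteq> 0" "Y \<noteq> 0" "h \<noteq> 0" using nX nY nh by auto
  have "?P ^ 2 dvd A * h * Y - g * B * X"
    using hyp3F2_Gamma_cong[OF p dvd abcd(1-5) e(1,2)]
    by (simp only: A_def B_def X_def Y_def g_def h_def \<epsilon>_def mult.assoc)
  \<comment> \<open>Division by the unit X h Y restores the quotients.\<close>
  then have "padic_cong (?o (A * h * Y - g * B * X) / ?o (X * (h * Y))) 0 2"
    using nX nY nh by (intro padic_cong_divide_unit padic_not_dvd_mult)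
  moreover have "?o (A * h * Y - g * B * X) / ?o (X * (h * Y)) = ?o A / ?o X - ?o g / ?o h * (?o B / ?o Y)"
    using nz by (simp add: field_simps)
  ultimately have AB: "padic_cong (?o A / ?o X - ?o g / ?o h * (?o B / ?o Y)) 0 2" by simp
  \<comment> \<open>The gamma quotient g / h is a p-adic integer, so multiplying by it preserves
    congruences.\<close>
  obtain v where v: "1 = h * v" using padic_unit[OF nh] by (rule dvdE)
  have "?o h * ?o v = 1" using v by (metis of_padic_int_hom(2,5))
  then have gh: "?o g / ?o h = ?o (g * v)" using nz by (simp add: field_simps)
  have "padic_cong (?o (- (g * v)) * (U - ?o B / ?o Y)) 0 2"
    by (rule padic_cong_0_mult[OF U])
  \<comment> \<open>The three congruences telescope to T - (g / h) U.\<close>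
  with T AB have "padic_cong ((T - ?o A / ?o X) + ((?o A / ?o X - ?o g / ?o h * (?o B / ?o Y))
      + ?o (- (g * v)) * (U - ?o B / ?o Y))) 0 2"
    by (intro padic_cong_0_add)
  moreover have "?o (- (g * v)) = - ?o (g * v)"
    using of_padic_int_hom(4)[of 0 "g * v"] by simp
  ultimately have "padic_cong (T - ?o g / ?o h * U) 0 2"
    unfolding gh by (simp add: algebra_simps)
  then show ?thesis
    unfolding padic_cong_0_iff[symmetric] T_def U_def g_def h_def
    by (simp add: assms(1) \<epsilon>_def algebra_simps)
qed

end
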